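(* Let $d\in\mathbb{N}$ be square-free, not a prime and not twice a prime, with $d>20$ and $d\neq 30$. Let $\zeta_d$ be a primitive $d$-th root of unity. Then the minimal polynomial $f\in\mathbb{Z}[x]$ of $\zeta_d+\zeta_d^{-1}$ is non-interlacing, i.e. there is no monic polynomial $g\in\mathbb{Z}[x]$ of degree $\deg f-1$ that interlaces $f$.
   Context: For $f=\prod_{i=1}^n(x-\alpha_i)$ with real roots and a monic $g=\prod_{i=1}^{n-1}(x-\beta_i)\in\mathbb{Z}[x]$, $g$ interlaces $f$ if $\alpha_1<\beta_1<\alpha_2<\cdots<\alpha_{n-1}<\beta_{n-1}<\alpha_n$ (all roots real). *)

theory Defs
  imports
    "HOL-Computational_Algebra.Computational_Algebra"
    Complex_Main
begin

definition primitive_root_of_unity :: "nat \<Rightarrow> complex \<Rightarrow> bool" where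
  "primitive_root_of_unity d \<zeta> \<longleftrightarrow>
     d > 0 \<and> \<zeta> ^ d = 1 \<and> (\<forall>k. 0 < k \<and> k < d \<longrightarrow> \<zeta> ^ k \<noteq> 1)"

text \<open>
  Minimality is over the rationals: \<open>f\<close> is the minimal polynomial of \<open>x\<close> in the usual sense,
  which for an algebraic integer \<open>x\<close> happens to have integer coefficients.
\<close>
definition is_min_int_poly :: "int poly \<Rightarrow> complex \<Rightarrow> bool" where
  "is_min_int_poly f x \<longleftrightarrow>
     lead_coeff f = 1 \<and> poly (map_poly of_int f) x = 0 \<and>
     (\<forall>q :: rat poly. q \<noteq> 0 \<and> poly (map_poly of_rat q) x = 0 \<longrightarrow> degree f \<le> degree q)"

text \<open>
  Such an \<open>f\<close> exists and is unique for the numbers of interest. The Dickson polynomials \<open>D n\<close>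
  satisfy \<open>D n (z + 1 / z) = z ^ n + 1 / z ^ n\<close>, which yields a monic integer polynomial with root
  \<open>\<zeta> + 1 / \<zeta>\<close>; the Gauss lemma does the rest.
\<close>

lemma clear_denominators:
  fixes q :: "rat poly"
  shows "\<exists>c r. c \<noteq> 0 \<and> smult (of_int c) q = map_poly of_int (r :: int poly)"
proof (induction q)
  case 0
  show ?case by (rule exI[of _ 1], rule exI[of _ 0]) simp
next
  case (pCons a q)
  obtain c r where cr: "c \<noteq> 0" "smult (of_int c) q = map_poly of_int r"
    using pCons by blast
  obtain u v where uv: "a = of_int u / of_int v" "v > 0"
    by (metis quotient_of_denom_pos quotient_of_div surj_pair)
  have "smult (of_int (v * c)) (pCons a q) = map_poly of_int (pCons (c * u) (smult v r))"
    using cr uv by (auto simp: map_poly_pCons map_poly_smult simp flip: smult_smult)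
  moreover have "v * c \<noteq> 0" using cr uv by simp
  ultimately show ?case by blast
qed

lemma poly_of_rat_of_int:
  "map_poly of_rat (map_poly of_int p) = (map_poly of_int p :: complex poly)"
  by (rule poly_eqI) (simp add: coeff_map_poly)

lemma of_int_poly_mult:
  "map_poly of_int (p * q) = (map_poly of_int p * map_poly of_int q :: complex poly)"
  by (rule poly_eqI) (simp add: coeff_map_poly coeff_mult)

lemma of_int_poly_diff:
  "map_poly of_int (p - q) = (map_poly of_int p - map_poly of_int q :: complex poly)"
  by (rule poly_eqI) (simp add: coeff_map_poly)

lemma is_min_int_poly_exists:
  fixes p :: "int poly"
  assumes "lead_coeff p = 1" "poly (map_poly of_int p) x = 0"
  shows "\<exists>f. is_min_int_poly f x"
proof -
  define P where "P = (\<lambda>q :: int poly. q \<noteq> 0 \<and> poly (map_poly of_int q) x = 0)"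
  have "P p" using assms by (auto simp: P_def)
  then obtain q0 where q0: "P q0" "\<And>r. P r \<Longrightarrow> degree q0 \<le> degree r"
    using ex_has_least_nat[of P p degree] by blast
  obtain q where q: "q0 = smult (content q0) q" "content q = 1"
    using content_decompose by blast
  have c0: "content q0 \<noteq> 0" using q0 by (simp add: P_def)
  have deg_q: "degree q = degree q0" using q(1) c0 by (metis degree_smult_eq)
  have "poly (map_poly of_int q) x = 0"
  proof -
    have "map_poly of_int q0 = (smult (of_int (content q0)) (map_poly of_int q) :: complex poly)"
      by (subst q(1)) (rule poly_eqI, simp add: coeff_map_poly)
    thus ?thesis using q0(1) by (auto simp: P_def)
  qed
  hence Pq: "P q" using q by (auto simp: P_def)
  have q_min: "degree q \<le> degree r" if "P r" for r using q0(2)[OF that] deg_q by simp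
  obtain s r where sr: "pseudo_divmod p q = (s, r)" by force
  define c where "c = lead_coeff q ^ (Suc (degree p) - degree q)"
  have div: "smult c p = q * s + r" "r = 0 \<or> degree r < degree q"
    using pseudo_divmod[OF _ sr] Pq by (auto simp: P_def c_def)
  have "r = 0"
  proof (rule ccontr)
    assume "r \<noteq> 0"
    have "r = smult c p - q * s" using div by simp
    hence "map_poly of_int r = (map_poly of_int ([:c:] * p) - map_poly of_int (q * s) :: complex poly)"
      by (simp flip: of_int_poly_diff)
    hence "poly (map_poly of_int r) x = 0"
      using assms Pq unfolding of_int_poly_mult P_def by simp
    with \<open>r \<noteq> 0\<close> have "P r" by (simp add: P_def)
    thus False using q_min div(2) \<open>r \<noteq> 0\<close> by fastforce
  qed
  hence eq: "smult c p = q * s" using div by simp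
  have "c \<noteq> 0" using Pq by (simp add: c_def P_def)
  have "content p dvd lead_coeff p" by (rule content_dvd_coeff)
  hence "is_unit (content p)" using assms by simp
  hence cp: "content p = 1" by (metis is_unit_content_iff)
  have "content (smult c p) = content s" unfolding eq by (simp add: content_mult q)
  hence cs: "content s = normalize c" using cp by simp
  obtain s' where s': "s = smult (normalize c) s'" using content_decompose cs by metis
  have "c dvd normalize c" by simp
  then obtain k where k: "normalize c = c * k" by blast
  have "smult c p = smult c (smult k (q * s'))" using eq s' k by simp
  hence "p = smult k (q * s')" using \<open>c \<noteq> 0\<close> by (auto simp: poly_eq_iff simp del: smult_smult)
  hence "lead_coeff p = k * (lead_coeff q * lead_coeff s')"
    by (simp only: lead_coeff_smult lead_coeff_mult)
  hence "1 = lead_coeff q * (k * lead_coeff s')" using assms(1) by (simp add: ac_simps)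
  hence "lead_coeff q dvd 1" by (rule dvdI)
  hence lq: "lead_coeff q = 1 \<or> lead_coeff q = - 1" by (simp add: abs_if split: if_splits)
  define f where "f = (if lead_coeff q = 1 then q else - q)"
  have Pf: "P f" "lead_coeff f = 1" "degree f = degree q"
    using lq Pq of_int_poly_diff[of 0 q] by (auto simp: f_def P_def)
  have "degree f \<le> degree t" if t: "t \<noteq> 0" "poly (map_poly of_rat t) x = 0" for t :: "rat poly"
  proof -
    obtain d u where du: "d \<noteq> 0" "smult (of_int d) t = map_poly of_int (u :: int poly)"
      using clear_denominators by blast
    have "map_poly of_int u = (smult (of_int d) (map_poly of_rat t) :: complex poly)"
      unfolding poly_of_rat_of_int[symmetric] du(2)[symmetric]
      by (rule poly_eqI) (simp add: coeff_map_poly of_rat_mult)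
    hence "poly (map_poly of_int u) x = 0" using t by simp
    moreover have deg: "degree u = degree t"
    proof -
      have "degree u = degree (map_poly of_int u :: rat poly)" by (simp add: degree_map_poly)
      also have "\<dots> = degree (smult (of_int d) t)" by (simp only: du(2))
      finally show ?thesis using du(1) by simp
    qed
    moreover have "u \<noteq> 0" using du t by auto
    ultimately show ?thesis using q_min[of u] Pf by (simp add: P_def)
  qed
  thus ?thesis using Pf unfolding is_min_int_poly_def P_def by blast
qed

lemma is_min_int_poly_unique:
  assumes f: "is_min_int_poly f x" and g: "is_min_int_poly g x"
  shows "f = g"
proof (rule ccontr)
  assume "f \<noteq> g"
  have min: "degree p \<le> degree q"
    if "is_min_int_poly p x" "q \<noteq> 0" "poly (map_poly of_int q) x = 0" for p q :: "int poly"
  proof -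
    have "map_poly of_int q \<noteq> (0 :: rat poly)" using that(2) by (simp add: poly_eq_iff coeff_map_poly)
    thus ?thesis using that unfolding is_min_int_poly_def
      by (metis degree_map_poly of_int_eq_0_iff poly_of_rat_of_int)
  qed
  have nz: "f \<noteq> 0" "g \<noteq> 0" using f g by (auto simp: is_min_int_poly_def)
  have roots: "poly (map_poly of_int f) x = 0" "poly (map_poly of_int g) x = 0"
    using f g by (auto simp: is_min_int_poly_def)
  have deg: "degree f = degree g"
    using min[OF f nz(2) roots(2)] min[OF g nz(1) roots(1)] by simp
  have "degree f \<le> degree (f - g)"
    by (rule min[OF f]) (use \<open>f \<noteq> g\<close> roots in \<open>auto simp: of_int_poly_diff\<close>)
  moreover have "coeff (f - g) (degree f) = 0"
    using f g deg by (simp add: is_min_int_poly_def)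
  moreover have "degree (f - g) \<le> degree f" using deg by (simp add: degree_diff_le)
  ultimately show False using \<open>f \<noteq> g\<close>
    by (metis eq_iff_diff_eq_0 le_antisym leading_coeff_0_iff)
qed

fun dickson :: "nat \<Rightarrow> int poly" where
  "dickson 0 = [:2:]"
| "dickson (Suc 0) = [:0, 1:]"
| "dickson (Suc (Suc n)) = pCons 0 (dickson (Suc n)) - dickson n"

lemma poly_dickson:
  assumes "z \<noteq> (0 :: complex)"
  shows "poly (map_poly of_int (dickson n)) (z + inverse z) = z ^ n + inverse z ^ n"
  by (induction n rule: dickson.induct)
     (use assms in \<open>auto simp: map_poly_pCons of_int_poly_diff field_simps\<close>)

lemma dickson_monic: "degree (dickson (Suc n)) = Suc n \<and> lead_coeff (dickson (Suc n)) = 1"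
proof (induction n rule: less_induct)
  case (less n)
  show ?case
  proof (cases n)
    case (Suc m)
    have IH: "degree (dickson n) = n" "coeff (dickson n) n = 1"
      using less[of m] Suc by auto
    have dm: "degree (dickson m) \<le> m"
      using less[of "m - 1"] Suc by (cases m) auto
    have "coeff (dickson (Suc n)) (Suc n) = 1"
      using IH dm Suc by (simp add: coeff_eq_0)
    moreover have "degree (dickson (Suc n)) \<le> Suc n"
      unfolding Suc dickson.simps
      by (rule degree_diff_le) (use IH dm Suc in \<open>auto intro: order.trans[OF degree_pCons_le]\<close>)
    ultimately show ?thesis by (metis le_antisym le_degree one_neq_zero)
  qed simp
qed

lemma is_min_int_poly_ex1:
  assumes "primitive_root_of_unity d \<zeta>"
  shows "\<exists>!f. is_min_int_poly f (\<zeta> + inverse \<zeta>)"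
proof -
  from assms have d: "d > 0" "\<zeta> ^ d = 1" by (auto simp: primitive_root_of_unity_def)
  then obtain n where n: "d = Suc n" by (cases d) auto
  have "\<zeta> \<noteq> 0" using d by (auto simp: power_0_left)
  define p where "p = dickson d - [:2:]"
  have "degree p = d" "lead_coeff p = 1"
  proof -
    have "degree p = d" unfolding p_def diff_conv_add_uminus
      by (subst degree_add_eq_left) (use dickson_monic[of n] n in auto)
    thus "degree p = d" "lead_coeff p = 1"
      using dickson_monic[of n] n by (auto simp: p_def)
  qed
  moreover have "poly (map_poly of_int p) (\<zeta> + inverse \<zeta>) = 0"
    using poly_dickson[OF \<open>\<zeta> \<noteq> 0\<close>, of d] d
    by (simp add: p_def of_int_poly_diff map_poly_pCons power_inverse)
  ultimately show ?thesis
    using is_min_int_poly_exists is_min_int_poly_unique by blast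
qed

text \<open>
  The roots are indexed from 1, as \<open>\<alpha> 1 < \<beta> 1 < \<alpha> 2 < \<dots> < \<beta> (n - 1) < \<alpha> n\<close>. The equations
  force both polynomials to be monic with only real roots, of degrees \<open>n\<close> and \<open>n - 1\<close>;
  \<open>n \<ge> 1\<close> excludes the truncated subtraction \<open>0 - 1 = 0\<close>.
\<close>
definition interlaces :: "int poly \<Rightarrow> int poly \<Rightarrow> bool" where
  "interlaces g f \<longleftrightarrow>
     (\<exists>(n :: nat) (\<alpha> :: nat \<Rightarrow> real) (\<beta> :: nat \<Rightarrow> real).
        n \<ge> 1 \<and>
        map_poly of_int f = (\<Prod>i = 1..n. [:- \<alpha> i, 1:]) \<and>
        map_poly of_int g = (\<Prod>i = 1..n - 1. [:- \<beta> i, 1:]) \<and>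
        (\<forall>i. 1 \<le> i \<and> i < n \<longrightarrow> \<alpha> i < \<beta> i \<and> \<beta> i < \<alpha> (i + 1)))"

definition non_interlacing :: "int poly \<Rightarrow> bool" where
  "non_interlacing f \<longleftrightarrow>
     \<not> (\<exists>g :: int poly. lead_coeff g = 1 \<and> degree g = degree f - 1 \<and> interlaces g f)"

end

theory Submission
  imports Defs "HOL-Number_Theory.Totient"
begin

text \<open>
  If \<open>g\<close> interlaces \<open>f\<close>, the weights \<open>\<gamma>\<^sub>i = g \<alpha>\<^sub>i / f' \<alpha>\<^sub>i\<close> at the roots \<open>\<alpha>\<^sub>i = z\<^sub>i + 1 / z\<^sub>i\<close> of \<open>f\<close> are
  positive, have sum 1, and \<open>\<Sum> \<gamma>\<^sub>i P \<alpha>\<^sub>i\<close> is an integer for every integer polynomial \<open>P\<close>. Hence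
  \<open>X \<mapsto> 2 \<Sum> \<gamma>\<^sub>i |X z\<^sub>i|\<^sup>2\<close> is an even integral positive definite form on \<open>\<int>[\<zeta>]\<close> in which all powers of
  \<open>\<zeta>\<close> have norm 2: \<open>\<int>[\<zeta>]\<close> becomes a root lattice on which \<open>\<zeta>\<close> acts as an isometry. Its Gram matrix
  in the powers of \<open>\<zeta>\<close> is the Toeplitz matrix of \<open>c k = 2 \<Sum> \<gamma>\<^sub>i Re (z\<^sub>i\<^sup>k)\<close>, with \<open>c 0 = 2\<close> and
  \<open>c k \<in> {-1, 0, 1}\<close> unless \<open>\<zeta>\<^sup>k = \<plusminus>1\<close>.

  Passing to a power of \<open>\<zeta>\<close> one may assume that the order is \<open>p q\<close> with odd primes \<open>p \<noteq> q\<close> and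
  \<open>\<phi> (p q) > 10\<close> (this excludes \<open>p q = 15\<close>, which is realised by \<open>E\<^sub>8\<close>). The relations
  \<open>\<Sum>\<^sub>j \<zeta>\<^sup>q\<^sup>j = 0 = \<Sum>\<^sub>j \<zeta>\<^sup>p\<^sup>j\<close> force \<open>c k \<noteq> 0\<close> for some \<open>k\<close> prime to \<open>p q\<close>, so that after replacing \<open>\<zeta>\<close> by
  \<open>\<plusminus>\<zeta>\<^sup>k\<close> also \<open>c 1 = - 1\<close>. In rank at least 10 there are only two positive definite Toeplitz
  patterns of this kind, \<open>2, -1, 0, 0, \<dots>\<close> and \<open>2, -1, 1, -1, \<dots>\<close>, and the second becomes the
  first if \<open>1 + \<zeta>\<close> is taken as base vector and \<open>- \<zeta>\<close> as isometry. Then \<open>c\<close> is supported near the multiples of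
  some \<open>s + 1\<close> with \<open>\<zeta>\<^sup>s\<^sup>+\<^sup>1 = \<plusminus>1\<close>, which contradicts \<open>\<Sum>\<^sub>j c (2 q j) = 0\<close>.
\<close>

section \<open>Degrees of roots of unity\<close>

abbreviation ipoly :: "int poly \<Rightarrow> 'a :: comm_ring_1 \<Rightarrow> 'a" where
  "ipoly P x \<equiv> poly (map_poly of_int P) x"

lemma map_poly_of_int_ring:
  fixes P Q :: "int poly"
  shows "map_poly of_int (P + Q) = (map_poly of_int P + map_poly of_int Q :: 'a :: comm_ring_1 poly)"
    and "map_poly of_int (P - Q) = (map_poly of_int P - map_poly of_int Q :: 'a poly)"
    and "map_poly of_int (P * Q) = (map_poly of_int P * map_poly of_int Q :: 'a poly)"
  by (rule poly_eqI; simp add: coeff_map_poly coeff_mult)+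

lemma ipoly_simps [simp]:
  fixes P Q :: "int poly" and x :: "'a :: comm_ring_1"
  shows "ipoly (P + Q) x = ipoly P x + ipoly Q x"
    and "ipoly (P - Q) x = ipoly P x - ipoly Q x"
    and "ipoly (P * Q) x = ipoly P x * ipoly Q x"
    and "ipoly (smult c P) x = of_int c * ipoly P x"
    and "ipoly (pCons c P) x = of_int c + x * ipoly P x"
    and "ipoly 1 x = 1"
    and "ipoly (monom c n) x = of_int c * x ^ n"
  by (simp_all add: map_poly_of_int_ring map_poly_smult map_poly_pCons map_poly_monom poly_monom)

lemma ipoly_power [simp]: "ipoly (P ^ n) x = ipoly P (x :: 'a :: comm_ring_1) ^ n"
  by (induction n) auto

lemma ipoly_sum [simp]: "ipoly (\<Sum>a\<in>A. P a) (x :: 'a :: comm_ring_1) = (\<Sum>a\<in>A. ipoly (P a) x)"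
  by (induction A rule: infinite_finite_induct) auto

lemma monic_division:
  fixes f P :: "int poly"
  assumes "lead_coeff f = 1"
  obtains q r where "P = f * q + r" "r = 0 \<or> degree r < degree f"
proof -
  obtain q r where qr: "pseudo_divmod P f = (q, r)" by force
  have "f \<noteq> 0" using assms by auto
  from pseudo_divmod[OF this qr] assms show ?thesis by (intro that[of q r]) auto
qed

lemma min_poly_dvd:
  assumes f: "is_min_int_poly f x" and P: "ipoly P x = 0"
  shows "f dvd P"
proof -
  from f have lc: "lead_coeff f = 1" and fx: "ipoly f x = 0"
    and min: "\<And>q :: rat poly. q \<noteq> 0 \<Longrightarrow> poly (map_poly of_rat q) x = 0 \<Longrightarrow> degree f \<le> degree q"
    by (auto simp: is_min_int_poly_def)
  obtain q r where qr: "P = f * q + r" "r = 0 \<or> degree r < degree f"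
    using monic_division[OF lc] by blast
  have "r = 0"
  proof (rule ccontr)
    assume "r \<noteq> 0"
    have "ipoly r x = 0" using P fx qr(1) by simp
    moreover have "map_poly of_int r \<noteq> (0 :: rat poly)"
      using \<open>r \<noteq> 0\<close> by (simp add: poly_eq_iff coeff_map_poly)
    ultimately have "degree f \<le> degree (map_poly of_int r :: rat poly)"
      by (intro min) (simp_all add: poly_of_rat_of_int)
    also have "\<dots> = degree r" by (simp add: degree_map_poly)
    finally show False using qr(2) \<open>r \<noteq> 0\<close> by simp
  qed
  thus ?thesis using qr by simp
qed

section \<open>Frobenius congruences modulo a prime\<close>

lemma prime_dvd_binomial_power:
  fixes a b :: "'a :: comm_ring_1"
  assumes "prime r"
  shows "of_nat r dvd (a + b) ^ r - a ^ r - b ^ r"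
proof -
  have r: "r > 0" using assms prime_gt_0_nat by blast
  have "{..r} = insert 0 (insert r {0<..<r})" by auto
  hence "(a + b) ^ r = b ^ r + (a ^ r + (\<Sum>k\<in>{0<..<r}. of_nat (r choose k) * a ^ k * b ^ (r - k)))"
    unfolding binomial_ring using r by simp
  hence "(a + b) ^ r - a ^ r - b ^ r = (\<Sum>k\<in>{0<..<r}. of_nat (r choose k) * a ^ k * b ^ (r - k))"
    by simp
  also have "of_nat r dvd \<dots>"
  proof (intro dvd_sum dvd_mult2)
    fix k assume "k \<in> {0<..<r}"
    hence "r dvd r choose k" using assms by (intro dvd_choose_prime) auto
    thus "of_nat r dvd (of_nat (r choose k) :: 'a)" by (metis dvd_def of_nat_mult)
  qed
  finally show ?thesis .
qed

lemma prime_dvd_power_minus_self: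
  fixes a :: int
  assumes "prime r"
  shows "int r dvd a ^ r - a"
proof -
  have r: "r > 0" using assms prime_gt_0_nat by blast
  have nat: "int r dvd int n ^ r - int n" for n
  proof (induction n)
    case (Suc n)
    have "int r dvd ((int n + 1) ^ r - int n ^ r - 1 ^ r) + (int n ^ r - int n)"
      using prime_dvd_binomial_power[OF assms, of "int n" 1] Suc by (intro dvd_add) auto
    thus ?case by (simp add: algebra_simps)
  qed (use r in \<open>auto simp: power_0_left\<close>)
  have "int r dvd int (nat (a mod r)) ^ r - int (nat (a mod r))" by (rule nat)
  hence "[(a mod r) ^ r = a mod r] (mod r)" using r by (simp add: cong_iff_dvd_diff)
  hence "[a ^ r = a] (mod r)" by (simp add: cong_def power_mod)
  thus ?thesis by (simp add: cong_iff_dvd_diff)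
qed

text \<open>Modulo \<open>r\<close> the power map is additive and fixes integer coefficients
  (Fermat). The error \<open>H\<close> is one integer polynomial for all \<open>x\<close>, so the
  congruence holds in the ring generated by \<open>x\<close>.\<close>

lemma ipoly_frobenius:
  assumes "prime r"
  obtains H where "\<And>x :: complex. ipoly f (x ^ r) = ipoly f x ^ r + of_nat r * ipoly H x"
proof -
  have "\<exists>H. \<forall>x :: complex. ipoly f (x ^ r) = ipoly f x ^ r + of_nat r * ipoly H x"
  proof (induction f)
    case 0
    have "r > 0" using assms prime_gt_0_nat by blast
    thus ?case by (intro exI[of _ 0]) auto
  next
    case (pCons a g)
    then obtain H where H: "\<And>x :: complex. ipoly g (x ^ r) = ipoly g x ^ r + of_nat r * ipoly H x"
      by blast
    have "of_nat r dvd ([:a:] + pCons 0 g) ^ r - [:a:] ^ r - pCons 0 g ^ r"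
      by (rule prime_dvd_binomial_power[OF assms])
    then obtain K where K: "([:a:] + pCons 0 g) ^ r - [:a:] ^ r - pCons 0 g ^ r = of_nat r * K" by blast
    obtain b where b: "a ^ r - a = int r * b"
      using prime_dvd_power_minus_self[OF assms] by blast
    \<comment> \<open>\<open>K\<close> collects the mixed binomial terms, \<open>b\<close> is the
      Fermat quotient of \<open>a\<close>, and \<open>monom 1 r * H\<close> comes from the induction
      hypothesis.\<close>
    have "ipoly (pCons a g) (x ^ r) =
            ipoly (pCons a g) x ^ r + of_nat r * ipoly (monom 1 r * H - K - [:b:]) x" for x :: complex
    proof -
      have "ipoly (of_nat r) x = (of_nat r :: complex)"
        by (simp add: of_nat_poly map_poly_pCons)
      moreover have "ipoly (([:a:] + pCons 0 g) ^ r - [:a:] ^ r - pCons 0 g ^ r) x = ipoly (of_nat r * K) x"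
        by (simp only: K)
      ultimately have "(of_int a + x * ipoly g x) ^ r - of_int a ^ r - x ^ r * ipoly g x ^ r = of_nat r * ipoly K x"
        by (simp add: power_mult_distrib)
      moreover have "of_int (a ^ r - a) = (of_int (int r * b) :: complex)" by (simp only: b)
      ultimately show ?thesis by (simp add: H algebra_simps)
    qed
    thus ?case by blast
  qed
  thus ?thesis using that by blast
qed

lemma ipoly_pcompose:
  "ipoly (pcompose P Q) (x :: 'a :: comm_ring_1) = ipoly P (ipoly Q x)"
  by (induction P) (auto simp: pcompose_pCons)

lemma primitive_root_nonzero: "primitive_root_of_unity m \<omega> \<Longrightarrow> \<omega> \<noteq> 0"
  by (auto simp: primitive_root_of_unity_def power_0_left)

lemma primitive_root_power_eq_1_iff:
  assumes "primitive_root_of_unity m \<omega>"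
  shows "\<omega> ^ k = 1 \<longleftrightarrow> m dvd k"
proof
  assume "\<omega> ^ k = 1"
  moreover have "\<omega> ^ k = (\<omega> ^ m) ^ (k div m) * \<omega> ^ (k mod m)"
    by (simp flip: power_mult power_add)
  ultimately have "\<omega> ^ (k mod m) = 1" using assms by (simp add: primitive_root_of_unity_def)
  hence "k mod m = 0" using assms mod_less_divisor[of m k]
    unfolding primitive_root_of_unity_def by fastforce
  thus "m dvd k" by auto
qed (use assms in \<open>auto simp: primitive_root_of_unity_def power_mult\<close>)

lemma primitive_root_inj:
  assumes "primitive_root_of_unity m \<omega>"
  shows "inj_on (\<lambda>k. \<omega> ^ k) {0<..m}"
proof (rule linorder_inj_onI)
  fix a b assume ab: "a < b" "a \<in> {0<..m}" "b \<in> {0<..m}"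
  show "\<omega> ^ a \<noteq> \<omega> ^ b"
  proof
    assume "\<omega> ^ a = \<omega> ^ b"
    also have "\<omega> ^ b = \<omega> ^ a * \<omega> ^ (b - a)" using ab by (simp flip: power_add)
    finally have "\<omega> ^ (b - a) = 1" using primitive_root_nonzero[OF assms] by simp
    hence "m dvd b - a" using primitive_root_power_eq_1_iff[OF assms] by blast
    thus False using ab by (auto dest: dvd_imp_le)
  qed
qed auto

text \<open>
  Let \<open>x\<^sup>m - 1 = f h\<close> with \<open>f\<close> the minimal polynomial of \<open>\<omega>\<close>. If \<open>\<omega>\<^sup>k\<close> is a root of \<open>f\<close> and \<open>\<eta> = \<omega>\<^sup>k\<^sup>r\<close>
  is not, then \<open>h \<eta> = 0\<close>, so differentiating gives \<open>m \<eta>\<^sup>m\<^sup>-\<^sup>1 = f \<eta> h' \<eta>\<close>, and \<open>f \<eta> \<in> r \<int>[\<omega>]\<close>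
  by Frobenius. Hence \<open>r\<close> divides \<open>m\<close> in \<open>\<int>[\<omega>]\<close>, and therefore in \<open>\<int>\<close>.
\<close>
lemma min_poly_root_prime_power:
  assumes \<omega>: "primitive_root_of_unity m \<omega>" and f: "is_min_int_poly f \<omega>"
    and r: "prime r" "\<not> r dvd m" and k: "ipoly f (\<omega> ^ k) = 0"
  shows "ipoly f (\<omega> ^ (k * r)) = 0"
proof (rule ccontr)
  define \<eta> where "\<eta> = \<omega> ^ (k * r)"
  assume "ipoly f (\<omega> ^ (k * r)) \<noteq> 0"
  hence f\<eta>: "ipoly f \<eta> \<noteq> 0" by (simp add: \<eta>_def)
  have m: "m > 0" "\<omega> ^ m = 1" using \<omega> by (auto simp: primitive_root_of_unity_def)
  have "\<eta> ^ m = (\<omega> ^ m) ^ (k * r)" unfolding \<eta>_def by (metis power_mult mult.commute)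
  hence \<eta>m: "\<eta> ^ m = 1" using m by simp
  have "f dvd monom 1 m - 1" using m by (intro min_poly_dvd[OF f]) simp
  then obtain h where h: "monom 1 m - 1 = f * h" by blast
  have "ipoly f \<eta> * ipoly h \<eta> = 0"
    using arg_cong[OF h, of "\<lambda>P. ipoly P \<eta>"] \<eta>m by simp
  hence h\<eta>: "ipoly h \<eta> = 0" using f\<eta> by simp
  have "monom (int m) (m - 1) = f * pderiv h + h * pderiv f"
    using arg_cong[OF h, of pderiv] by (simp add: pderiv_diff pderiv_monom pderiv_mult)
  from arg_cong[OF this, of "\<lambda>P. ipoly P \<eta>"]
  have "of_nat m * \<eta> ^ (m - 1) = ipoly f \<eta> * ipoly (pderiv h) \<eta>" using h\<eta> by simp
  hence "of_nat m * \<eta> ^ (m - 1) * \<eta> = ipoly f \<eta> * ipoly (pderiv h) \<eta> * \<eta>" by simp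
  moreover have "\<eta> ^ (m - 1) * \<eta> = 1" using \<eta>m m(1) by (cases m) (auto simp: mult.commute)
  ultimately have eq: "of_nat m = ipoly f \<eta> * ipoly (pderiv h) \<eta> * \<eta>" by (metis mult.assoc mult.right_neutral)
  obtain H where H: "\<And>x :: complex. ipoly f (x ^ r) = ipoly f x ^ r + of_nat r * ipoly H x"
    using ipoly_frobenius[OF r(1)] by blast
  have "ipoly f \<eta> = of_nat r * ipoly H (\<omega> ^ k)"
    using H[of "\<omega> ^ k"] k prime_gt_0_nat[OF r(1)] by (simp add: \<eta>_def power_mult)
  moreover define G where
    "G = pcompose H (monom 1 k) * pcompose (pderiv h) (monom 1 (k * r)) * monom 1 (k * r)"
  ultimately have G: "of_nat m = of_nat r * ipoly G \<omega>"
    using eq by (simp add: \<eta>_def ipoly_pcompose)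
  \<comment> \<open>Reducing \<open>G\<close> modulo \<open>f\<close> gives a relation of degree
    below that of \<open>f\<close>, which must hold identically; its constant coefficients give
    divisibility in the integers.\<close>
  obtain q R where qR: "G = f * q + R" "R = 0 \<or> degree R < degree f"
    using monic_division[of f G] f by (auto simp: is_min_int_poly_def)
  have f\<omega>: "ipoly f \<omega> = 0" "lead_coeff f = 1" using f by (auto simp: is_min_int_poly_def)
  have deg: "degree f > 0"
  proof (rule ccontr)
    assume "\<not> degree f > 0"
    hence "f = [:1:]" using f\<omega>(2) by (auto elim!: degree_eq_zeroE)
    thus False using f\<omega>(1) by simp
  qed
  have "f dvd smult (int r) R - [:int m:]"
    using G qR(1) f\<omega> by (intro min_poly_dvd[OF f]) simp
  moreover have "degree (smult (int r) R - [:int m:]) < degree f"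
    using qR(2) deg by (intro degree_diff_less) (auto intro: le_less_trans[OF degree_smult_le])
  ultimately have "smult (int r) R - [:int m:] = 0"
    by (meson dvd_imp_degree_le not_less)
  hence "coeff (smult (int r) R - [:int m:]) 0 = 0" by simp
  hence "int m = int r * coeff R 0" by simp
  hence "int r dvd int m" by simp
  thus False using r(2) by simp
qed

text \<open>Splitting prime factors off the exponent one at a time makes all
  \<open>\<omega> ^ k\<close> with \<open>k\<close> prime to \<open>m\<close> roots of one minimal
  polynomial. The bound later yields linear independence of low powers.\<close>

theorem totient_le_degree:
  assumes \<omega>: "primitive_root_of_unity m \<omega>" and P: "P \<noteq> 0" "ipoly P \<omega> = 0"
  shows "totient m \<le> degree P"
proof -
  have m: "m > 0" "\<omega> ^ m = 1" using \<omega> by (auto simp: primitive_root_of_unity_def)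
  have "degree (monom 1 m - 1 :: int poly) = m"
    using m by (subst diff_conv_add_uminus, subst degree_add_eq_left) (auto simp: degree_monom_eq)
  hence "\<exists>f. is_min_int_poly f \<omega>"
    using m by (intro is_min_int_poly_exists[of "monom 1 m - 1"]) auto
  then obtain f where f: "is_min_int_poly f \<omega>" by blast
  hence f\<omega>: "ipoly f \<omega> = 0" "f \<noteq> 0" by (auto simp: is_min_int_poly_def)
  have root: "ipoly f (\<omega> ^ k) = 0" if "coprime k m" "k > 0" for k
    using that
  proof (induction k rule: less_induct)
    case (less k)
    show ?case
    proof (cases "k = 1")
      case False
      then obtain r where r: "prime r" "r dvd k" using prime_factor_nat by blast
      then obtain l where l: "k = l * r" by (auto simp: mult.commute)
      have "l < k" "l > 0" using l less.prems prime_gt_1_nat[OF r(1)] by auto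
      moreover have "coprime l m" using less.prems l by simp
      moreover have "\<not> r dvd m"
        using less.prems r by (meson coprime_common_divisor not_prime_unit)
      ultimately have "ipoly f (\<omega> ^ l) = 0" "\<not> r dvd m" using less.IH by blast+
      thus ?thesis unfolding l using min_poly_root_prime_power[OF \<omega> f r(1)] by blast
    qed (use f\<omega> in simp)
  qed
  have "totient m = card ((\<lambda>k. \<omega> ^ k) ` totatives m)"
    unfolding totient_def
    by (intro card_image[symmetric] inj_on_subset[OF primitive_root_inj[OF \<omega>]] totatives_subset)
  also have "\<dots> \<le> card {x :: complex. ipoly f x = 0}"
  proof (rule card_mono)
    show "finite {x :: complex. ipoly f x = 0}"
      using f\<omega>(2) by (intro poly_roots_finite) (auto simp: poly_eq_iff coeff_map_poly)
    show "(\<lambda>k. \<omega> ^ k) ` totatives m \<subseteq> {x. ipoly f x = 0}"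
      using root by (auto simp: in_totatives_iff)
  qed
  also have "\<dots> \<le> degree (map_poly of_int f :: complex poly)"
    using f\<omega>(2) by (intro card_poly_roots_bound) (auto simp: poly_eq_iff coeff_map_poly)
  also have "\<dots> = degree f" by (simp add: degree_map_poly)
  also have "\<dots> \<le> degree P" using min_poly_dvd[OF f P(2)] P(1) by (intro dvd_imp_degree_le)
  finally show ?thesis .
qed

section \<open>Weights of an interlacing polynomial\<close>

text \<open>Compare coefficients in the Lagrange interpolation formula: each basis polynomial
  \<open>B i\<close> is monic of degree \<open>card A - 1\<close>.\<close>

lemma lagrange_coeff:
  fixes x :: "'b \<Rightarrow> 'a :: field"
  assumes A: "finite A" "inj_on x A" and deg: "degree R < card A"
  shows "(\<Sum>i\<in>A. poly R (x i) / (\<Prod>j\<in>A - {i}. x i - x j)) = coeff R (card A - 1)"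
proof -
  define D where "D = (\<lambda>i. \<Prod>j\<in>A - {i}. x i - x j)"
  define B where "B = (\<lambda>i. \<Prod>j\<in>A - {i}. [:- x j, 1:])"
  define L where "L = (\<Sum>i\<in>A. smult (poly R (x i) / D i) (B i))"
  have D: "D i \<noteq> 0" if "i \<in> A" for i
    using A that by (auto simp: D_def inj_on_def)
  have degB: "degree (B i) = card A - 1" if "i \<in> A" for i
    using A that by (simp add: B_def degree_prod_sum_eq)
  have coeffB: "coeff (B i) (card A - 1) = 1" if "i \<in> A" for i
    using degB[OF that, symmetric] by (simp add: B_def lead_coeff_prod)
  have polyB: "poly (B i) (x k) = (if i = k then D k else 0)" if "i \<in> A" "k \<in> A" for i k
    using A that by (auto simp: B_def D_def poly_prod intro!: prod.cong)
  have "poly L (x k) = poly R (x k)" if "k \<in> A" for k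
  proof -
    have "poly L (x k) = (\<Sum>i\<in>A. if i = k then poly R (x k) else 0)"
      unfolding L_def poly_sum using that D by (intro sum.cong) (auto simp: polyB)
    thus ?thesis using A that by simp
  qed
  moreover have "degree L \<le> card A - 1"
    unfolding L_def by (intro degree_sum_le A order.trans[OF degree_smult_le]) (simp add: degB)
  ultimately have "L = R"
    using deg A by (intro poly_eqI_degree[of "x ` A"]) (auto simp: card_image)
  hence "coeff R (card A - 1) = coeff L (card A - 1)" by simp
  also have "\<dots> = (\<Sum>i\<in>A. poly R (x i) / D i * coeff (B i) (card A - 1))"
    by (simp add: L_def coeff_sum)
  also have "\<dots> = (\<Sum>i\<in>A. poly R (x i) / D i)"
    by (intro sum.cong) (auto simp: coeffB simp del: One_nat_def)
  finally show ?thesis by (simp add: D_def)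
qed

lemma interlacing_strict_mono:
  fixes \<alpha> \<beta> :: "nat \<Rightarrow> real"
  assumes inter: "\<And>i. 1 \<le> i \<Longrightarrow> i < n \<Longrightarrow> \<alpha> i < \<beta> i \<and> \<beta> i < \<alpha> (i + 1)"
    and "1 \<le> i" "i < j" "j \<le> n"
  shows "\<alpha> i < \<alpha> j"
  using assms(3,4)
proof (induction j)
  case (Suc j)
  show ?case
  proof (cases "i = j")
    case False
    hence "\<alpha> i < \<alpha> j" using Suc by auto
    also have "\<alpha> j < \<alpha> (Suc j)" using inter[of j] Suc.prems assms(2) by auto
    finally show ?thesis .
  qed (use inter[of i] Suc.prems assms(2) in auto)
qed auto

text \<open>Cut both products at \<open>i\<close>: pair \<open>\<beta> j\<close> with
  \<open>\<alpha> j\<close> before the cut and with \<open>\<alpha> (j + 1)\<close> from it on. The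
  two factors of each pair have the same sign.\<close>

lemma interlacing_quotient_pos:
  fixes \<alpha> \<beta> :: "nat \<Rightarrow> real"
  assumes inter: "\<And>i. 1 \<le> i \<Longrightarrow> i < n \<Longrightarrow> \<alpha> i < \<beta> i \<and> \<beta> i < \<alpha> (i + 1)"
    and i: "i \<in> {1..n}"
  shows "(\<Prod>j = 1..n - 1. \<alpha> i - \<beta> j) / (\<Prod>j\<in>{1..n} - {i}. \<alpha> i - \<alpha> j) > 0"
proof -
  note mono = interlacing_strict_mono[of n \<alpha> \<beta>, OF inter]
  have lower: "\<alpha> i > \<beta> j \<and> \<alpha> i > \<alpha> j" if "j \<in> {1..<i}" for j
    using inter[of j] mono[of j i] mono[of "j + 1" i] that i by (cases "j + 1 = i") auto
  have upper: "\<alpha> i < \<beta> j \<and> \<alpha> i < \<alpha> (j + 1)" if "j \<in> {i..<n}" for j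
    using inter[of j] mono[of i j] mono[of i "j + 1"] that i by (cases "i = j") auto
  have "{1..n - 1} = {1..<i} \<union> {i..<n}" using i by auto
  hence "(\<Prod>j = 1..n - 1. \<alpha> i - \<beta> j) = (\<Prod>j\<in>{1..<i}. \<alpha> i - \<beta> j) * (\<Prod>j\<in>{i..<n}. \<alpha> i - \<beta> j)"
    by (simp add: prod.union_disjoint ivl_disj_int)
  moreover have "(\<Prod>j\<in>{1..n} - {i}. \<alpha> i - \<alpha> j) =
      (\<Prod>j\<in>{1..<i}. \<alpha> i - \<alpha> j) * (\<Prod>j\<in>{i..<n}. \<alpha> i - \<alpha> (j + 1))"
  proof -
    have "{1..n} - {i} = {1..<i} \<union> {i+1..<n+1}" using i by auto
    hence "(\<Prod>j\<in>{1..n} - {i}. \<alpha> i - \<alpha> j) =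
        (\<Prod>j\<in>{1..<i}. \<alpha> i - \<alpha> j) * (\<Prod>j\<in>{i+1..<n+1}. \<alpha> i - \<alpha> j)"
      by (simp only:) (intro prod.union_disjoint, auto)
    thus ?thesis by (simp only: prod.shift_bounds_nat_ivl)
  qed
  ultimately have "(\<Prod>j = 1..n - 1. \<alpha> i - \<beta> j) / (\<Prod>j\<in>{1..n} - {i}. \<alpha> i - \<alpha> j) =
      (\<Prod>j\<in>{1..<i}. (\<alpha> i - \<beta> j) / (\<alpha> i - \<alpha> j)) *
      (\<Prod>j\<in>{i..<n}. (\<alpha> i - \<beta> j) / (\<alpha> i - \<alpha> (j + 1)))"
    by (simp add: prod_dividef)
  also have "\<dots> > 0"
    using lower upper by (intro mult_pos_pos prod_pos) (auto simp: divide_neg_neg)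
  finally show ?thesis .
qed

text \<open>At the roots of \<open>f\<close>, \<open>g * P\<close> agrees with its remainder modulo
  \<open>f\<close>, and \<open>lagrange_coeff\<close> turns the weighted sum into an integer
  coefficient of that remainder. The total weight is likewise the leading coefficient of
  \<open>g\<close>.\<close>

lemma interlacing_weights:
  assumes "interlaces g f"
  obtains n :: nat and \<alpha> \<gamma> :: "nat \<Rightarrow> real"
  where "n \<ge> 1" "\<And>i. i \<in> {1..n} \<Longrightarrow> \<gamma> i > 0 \<and> ipoly f (\<alpha> i) = 0"
    and "\<And>P :: int poly. (\<Sum>i = 1..n. \<gamma> i * ipoly P (\<alpha> i)) \<in> \<int>" "(\<Sum>i = 1..n. \<gamma> i) = 1"
proof -
  from assms obtain n :: nat and \<alpha> \<beta> :: "nat \<Rightarrow> real" where n: "n \<ge> 1"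
    and f: "map_poly of_int f = (\<Prod>i = 1..n. [:- \<alpha> i, 1:])"
    and g: "map_poly of_int g = (\<Prod>i = 1..n - 1. [:- \<beta> i, 1:])"
    and inter: "\<And>i. 1 \<le> i \<Longrightarrow> i < n \<Longrightarrow> \<alpha> i < \<beta> i \<and> \<beta> i < \<alpha> (i + 1)"
    unfolding interlaces_def by blast
  define D where "D = (\<lambda>i. \<Prod>j\<in>{1..n} - {i}. \<alpha> i - \<alpha> j)"
  define \<gamma> where "\<gamma> = (\<lambda>i. ipoly g (\<alpha> i) / D i)"
  have g\<alpha>: "ipoly g x = (\<Prod>j = 1..n - 1. x - \<beta> j)" for x :: real
    by (simp add: g poly_prod)
  have root: "ipoly f (\<alpha> i) = 0" if "i \<in> {1..n}" for i
    using that by (auto simp: f poly_prod)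
  have deg_f: "degree f = n"
  proof -
    have "degree (map_poly of_int f :: real poly) = n" unfolding f by (subst degree_prod_sum_eq) auto
    thus ?thesis by (simp add: degree_map_poly)
  qed
  have "real_of_int (lead_coeff f) = lead_coeff (map_poly of_int f :: real poly)"
    by (simp add: coeff_map_poly degree_map_poly)
  also have "\<dots> = 1" unfolding f by (simp add: lead_coeff_prod)
  finally have lc_f: "lead_coeff f = 1" by simp
  have inj: "inj_on \<alpha> {1..n}"
    using interlacing_strict_mono[of n \<alpha> \<beta>, OF inter] by (intro linorder_inj_onI) force+
  have lagrange: "(\<Sum>i = 1..n. poly R (\<alpha> i) / D i) = coeff R (n - 1)" if "degree R < n" for R
    using lagrange_coeff[of "{1..n}" \<alpha> R] inj that by (simp add: D_def)
  have "(\<Sum>i = 1..n. \<gamma> i * ipoly P (\<alpha> i)) \<in> \<int>" for P :: "int poly"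
  proof -
    obtain q r where qr: "g * P = f * q + r" "r = 0 \<or> degree r < degree f"
      using monic_division[OF lc_f] by blast
    have "(\<Sum>i = 1..n. \<gamma> i * ipoly P (\<alpha> i)) = (\<Sum>i = 1..n. ipoly r (\<alpha> i) / D i)"
    proof (rule sum.cong)
      fix i assume "i \<in> {1..n}"
      thus "\<gamma> i * ipoly P (\<alpha> i) = ipoly r (\<alpha> i) / D i"
        using arg_cong[OF qr(1), of "\<lambda>P. ipoly P (\<alpha> i)"] root by (simp add: \<gamma>_def)
    qed simp
    also have "\<dots> = coeff (map_poly of_int r) (n - 1)"
      using qr(2) n deg_f by (intro lagrange) (auto simp: degree_map_poly)
    also have "\<dots> \<in> \<int>" by (simp add: coeff_map_poly)
    finally show ?thesis .
  qed
  moreover have "(\<Sum>i = 1..n. \<gamma> i) = 1"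
  proof -
    have deg_g: "degree (map_poly of_int g :: real poly) = n - 1"
      unfolding g by (subst degree_prod_sum_eq) auto
    have "(\<Sum>i = 1..n. \<gamma> i) = coeff (map_poly of_int g) (n - 1)"
      unfolding \<gamma>_def by (rule lagrange) (use deg_g n in simp)
    also have "\<dots> = lead_coeff (map_poly of_int g :: real poly)" by (simp only: deg_g)
    also have "\<dots> = 1" unfolding g by (simp add: lead_coeff_prod)
    finally show ?thesis .
  qed
  moreover have "\<gamma> i > 0" if "i \<in> {1..n}" for i
    using interlacing_quotient_pos[of n \<alpha> \<beta> i, OF inter that] by (simp add: \<gamma>_def g\<alpha> D_def)
  ultimately show ?thesis using n root that by blast
qed

section \<open>Transfer of the weights to primitive roots of unity\<close>

lemma ipoly_of_real: "ipoly P (of_real x :: complex) = of_real (ipoly P x)"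
  by (induction P) auto

lemma exists_plus_inverse:
  fixes a :: complex
  obtains z where "z \<noteq> 0" "z + inverse z = a"
proof -
  define s where "s = csqrt (a\<^sup>2 - 4)"
  have "s\<^sup>2 = a\<^sup>2 - 4" by (simp add: s_def)
  hence 1: "(a + s) / 2 * ((a - s) / 2) = 1" by (simp add: field_simps power2_eq_square)
  hence "inverse ((a + s) / 2) = (a - s) / 2" by (rule inverse_unique)
  thus ?thesis using 1 by (intro that[of "(a + s) / 2"]) (auto simp: field_simps)
qed

lemma root_of_unity_norm:
  fixes z :: complex
  assumes "z ^ d = 1" "d > 0"
  shows "cmod z = 1"
  using assms by (metis norm_one norm_power norm_ge_zero power_eq_1_iff not_gr_zero)

lemma sum_powers_root_of_unity:
  fixes z :: complex
  assumes "z ^ d = 1" "z \<noteq> 1"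
  shows "(\<Sum>j<d. z ^ j) = 0"
  using assms by (simp add: geometric_sum)

text \<open>Each \<open>\<alpha> i\<close> inherits every integer polynomial relation satisfied by
  \<open>\<zeta> + inverse \<zeta>\<close>. Dickson polynomials encode the order of
  \<open>\<zeta>\<close> in such relations, and their values \<open>2 * Re (z i ^ k)\<close> make
  the moments integral.\<close>

lemma interlacing_root_weights:
  assumes \<zeta>: "primitive_root_of_unity d \<zeta>" and f: "is_min_int_poly f (\<zeta> + inverse \<zeta>)"
    and g: "interlaces g f"
  shows "\<exists>(n :: nat) (\<gamma> :: nat \<Rightarrow> real) z.
    (\<forall>i\<in>{1..n}. \<gamma> i > 0 \<and> primitive_root_of_unity d (z i)) \<and>
    (\<forall>k. 2 * (\<Sum>i = 1..n. \<gamma> i * Re (z i ^ k)) \<in> \<int>) \<and> (\<Sum>i = 1..n. \<gamma> i) = 1"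
proof -
  obtain n :: nat and \<alpha> \<gamma> :: "nat \<Rightarrow> real"
    where n: "n \<ge> 1" "\<And>i. i \<in> {1..n} \<Longrightarrow> \<gamma> i > 0 \<and> ipoly f (\<alpha> i) = 0"
    and int: "\<And>P :: int poly. (\<Sum>i = 1..n. \<gamma> i * ipoly P (\<alpha> i)) \<in> \<int>" "(\<Sum>i = 1..n. \<gamma> i) = 1"
    by (rule interlacing_weights[OF g]) (rule that)
  have "\<exists>z. z \<noteq> 0 \<and> z + inverse z = complex_of_real (\<alpha> i)" for i
    by (rule exists_plus_inverse) blast
  hence "\<exists>z. \<forall>i. z i \<noteq> 0 \<and> z i + inverse (z i) = complex_of_real (\<alpha> i)" by (intro choice) simp
  then obtain z where z: "z i \<noteq> 0" "z i + inverse (z i) = complex_of_real (\<alpha> i)" for i by blast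
  have d: "d > 0" "\<zeta> ^ d = 1" "\<zeta> \<noteq> 0"
    using \<zeta> primitive_root_nonzero[OF \<zeta>] by (auto simp: primitive_root_of_unity_def)
  have dick: "ipoly (dickson k) (complex_of_real (\<alpha> i)) = z i ^ k + inverse (z i) ^ k" for i k
    using poly_dickson[OF z(1), of k i] by (simp add: z(2))
  have transfer: "ipoly P (complex_of_real (\<alpha> i)) = 0"
    if "i \<in> {1..n}" "ipoly P (\<zeta> + inverse \<zeta>) = 0" for P i
  proof -
    from min_poly_dvd[OF f that(2)] obtain Q where "P = f * Q" by blast
    thus ?thesis using n(2)[OF that(1)] by (simp add: ipoly_of_real)
  qed
  have prim: "primitive_root_of_unity d (z i)" if i: "i \<in> {1..n}" for i
  proof -
    have "ipoly (dickson d - [:2:]) (complex_of_real (\<alpha> i)) = 0"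
      using poly_dickson[OF d(3), of d] d by (intro transfer i) (simp add: power_inverse)
    hence "z i ^ d + inverse (z i) ^ d = 2" by (simp add: dick)
    hence "(z i ^ d - 1)\<^sup>2 = 0" using z(1)[of i] by (simp add: field_simps power2_eq_square)
    hence zd: "z i ^ d = 1" by simp
    have "z i ^ k \<noteq> 1" if k: "0 < k" "k < d" for k
    proof
      assume zk: "z i ^ k = 1"
      \<comment> \<open>The sum of \<open>dickson (k * j)\<close> over \<open>j < d\<close> vanishes
        at \<open>\<zeta> + inverse \<zeta>\<close>, but would be \<open>2 * d\<close> at
        \<open>\<alpha> i\<close> if \<open>z i ^ k = 1\<close>.\<close>
      have "\<zeta> ^ k \<noteq> 1" using \<zeta> k by (simp add: primitive_root_of_unity_def)
      moreover have "(\<zeta> ^ k) ^ d = 1" using d by (metis power_mult mult.commute power_one)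
      ultimately have sums: "(\<Sum>j<d. (\<zeta> ^ k) ^ j) = 0" "(\<Sum>j<d. inverse (\<zeta> ^ k) ^ j) = 0"
        using sum_powers_root_of_unity[of "\<zeta> ^ k" d] sum_powers_root_of_unity[of "inverse (\<zeta> ^ k)" d]
        by (simp_all only: power_inverse inverse_1 inverse_eq_1_iff simp_thms)
      have "ipoly (\<Sum>j<d. dickson (k * j)) (\<zeta> + inverse \<zeta>) =
          (\<Sum>j<d. (\<zeta> ^ k) ^ j + inverse (\<zeta> ^ k) ^ j)"
        unfolding ipoly_sum poly_dickson[OF d(3)] by (simp add: power_mult power_inverse)
      also have "\<dots> = 0" using sums by (simp only: sum.distrib) simp
      finally have "ipoly (\<Sum>j<d. dickson (k * j)) (\<zeta> + inverse \<zeta>) = 0" .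
      from transfer[OF i this] have "(\<Sum>j<d. z i ^ (k * j) + inverse (z i) ^ (k * j)) = 0"
        by (simp add: dick)
      hence "of_nat d * (2 :: complex) = 0" using zk by (simp add: power_mult power_inverse)
      thus False using d by simp
    qed
    thus ?thesis using zd d by (simp add: primitive_root_of_unity_def)
  qed
  have "2 * (\<Sum>i = 1..n. \<gamma> i * Re (z i ^ k)) = (\<Sum>i = 1..n. \<gamma> i * ipoly (dickson k) (\<alpha> i))" for k
    unfolding sum_distrib_left
  proof (rule sum.cong)
    fix i assume "i \<in> {1..n}"
    hence "cmod (z i) = 1"
      using prim d root_of_unity_norm by (auto simp: primitive_root_of_unity_def)
    hence "z i * cnj (z i) = 1" by (simp flip: complex_norm_square)
    hence "inverse (z i) = cnj (z i)" by (rule inverse_unique)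
    hence "ipoly (dickson k) (complex_of_real (\<alpha> i)) = z i ^ k + cnj (z i ^ k)"
      using dick by simp
    also have "\<dots> = of_real (2 * Re (z i ^ k))" by (rule complex_add_cnj)
    finally have "ipoly (dickson k) (\<alpha> i) = 2 * Re (z i ^ k)"
      unfolding ipoly_of_real of_real_eq_iff .
    thus "2 * (\<gamma> i * Re (z i ^ k)) = \<gamma> i * ipoly (dickson k) (\<alpha> i)" by simp
  qed simp
  hence "2 * (\<Sum>i = 1..n. \<gamma> i * Re (z i ^ k)) \<in> \<int>" for k using int(1) by presburger
  with int(2) n(2) prim show ?thesis by blast
qed

section \<open>Positive definite Toeplitz prefixes\<close>

text \<open>
  \<open>toeplitz_form c xs\<close> is half the value at \<open>xs\<close> of the Toeplitz form with entries \<open>c |i - j|\<close> off the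
  diagonal and 2 on it; \<open>c 0\<close> itself is not consulted.
\<close>
primrec toeplitz_row :: "(nat \<Rightarrow> int) \<Rightarrow> int list \<Rightarrow> nat \<Rightarrow> int" where
  "toeplitz_row c [] k = 0"
| "toeplitz_row c (x # xs) k = x * c k + toeplitz_row c xs (k + 1)"

primrec toeplitz_form :: "(nat \<Rightarrow> int) \<Rightarrow> int list \<Rightarrow> int" where
  "toeplitz_form c [] = 0"
| "toeplitz_form c (x # xs) = x\<^sup>2 + x * toeplitz_row c xs 1 + toeplitz_form c xs"

lemma toeplitz_row_replicate: "toeplitz_row c (replicate n 0 @ [x]) k = x * c (k + n)"
  by (induction n arbitrary: k) auto

lemma toeplitz_form_replicate: "toeplitz_form c (replicate n 0 @ [x]) = x\<^sup>2"
  by (induction n) (auto simp: toeplitz_row_replicate)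

text \<open>
  An exhaustive search: each test vector is a vector of non-positive norm for some of the
  prolongations of a prefix of \<open>c\<close>.
\<close>
lemma toeplitz_prefix:
  assumes pos: "\<And>xs. length xs \<le> 10 \<Longrightarrow> \<exists>x\<in>set xs. x \<noteq> 0 \<Longrightarrow> toeplitz_form c xs > 0"
    and c1: "c 1 = - 1"
  shows "(\<forall>k\<in>{2..7}. c k = 0) \<or> (\<forall>k\<in>{1..8}. c k = (- 1) ^ k)"
proof -
  note [simp del] = One_nat_def
  \<comment> \<open>The entries 1 and \<open>x\<close> at distance \<open>k\<close> give the value
    \<open>2 + x * c k\<close> for \<open>x = 1\<close> and \<open>x = - 1\<close>. The list has
    length \<open>k + 1\<close>, so length 10 reaches \<open>k = 9\<close>.\<close>
  have b: "c k = - 1 \<or> c k = 0 \<or> c k = 1" if "2 \<le> k" "k \<le> 9" for k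
  proof -
    have "toeplitz_form c (1 # replicate (k - 1) 0 @ [x]) > 0" for x
      using that by (intro pos) auto
    from this[of 1] this[of "- 1"] that show ?thesis
      by (auto simp: toeplitz_row_replicate toeplitz_form_replicate)
  qed
  \<comment> \<open>Each \<open>L\<close> lists the prefixes surviving one further entry; the
    vectors tried have length one more than its index.\<close>
  note p =
    pos[of "[1, 1, 1]", simplified]
  have L2: "c 2 = 0 \<or>
      c 2 = 1"
    using c1 b[of 2, simplified]
    by (elim disjE conjE; insert p; simp (asm_lr))
  note p =
    pos[of "[1, 0, -1, -1]", simplified]
    pos[of "[1, 1, 1, 1]", simplified]
  have L3: "c 2 = 0 \<and> c 3 = 0 \<or>
      c 2 = 0 \<and> c 3 = 1 \<or>
      c 2 = 1 \<and> c 3 = - 1 \<or>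
      c 2 = 1 \<and> c 3 = 0"
    using c1 L2 b[of 3, simplified]
    by (elim disjE conjE; insert p; simp (asm_lr))
  note p =
    pos[of "[1, 1, 0, -1, -1]", simplified]
    pos[of "[1, 0, -1, 0, 1]", simplified]
    pos[of "[1, 1, 1, 1, 1]", simplified]
  have L4: "c 2 = 0 \<and> c 3 = 0 \<and> c 4 = 0 \<or>
      c 2 = 0 \<and> c 3 = 0 \<and> c 4 = 1 \<or>
      c 2 = 0 \<and> c 3 = 1 \<and> c 4 = - 1 \<or>
      c 2 = 1 \<and> c 3 = - 1 \<and> c 4 = 0 \<or>
      c 2 = 1 \<and> c 3 = - 1 \<and> c 4 = 1 \<or>
      c 2 = 1 \<and> c 3 = 0 \<and> c 4 = 0"
    using c1 L3 b[of 4, simplified]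
    by (elim disjE conjE; insert p; simp (asm_lr))
  note p =
    pos[of "[1, 1, 0, 0, -1, -1]", simplified]
    pos[of "[1, 0, -1, 0, 1, 1]", simplified]
    pos[of "[1, 0, 0, 1, 0, -1]", simplified]
    pos[of "[1, 1, 0, 0, 1, 1]", simplified]
    pos[of "[1, 1, 1, 1, 1, 1]", simplified]
  have L5: "c 2 = 0 \<and> c 3 = 0 \<and> c 4 = 0 \<and> c 5 = 0 \<or>
      c 2 = 0 \<and> c 3 = 0 \<and> c 4 = 0 \<and> c 5 = 1 \<or>
      c 2 = 0 \<and> c 3 = 0 \<and> c 4 = 1 \<and> c 5 = - 1 \<or>
      c 2 = 0 \<and> c 3 = 1 \<and> c 4 = - 1 \<and> c 5 = 0 \<or>
      c 2 = 0 \<and> c 3 = 1 \<and> c 4 = - 1 \<and> c 5 = 1 \<or>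
      c 2 = 1 \<and> c 3 = - 1 \<and> c 4 = 0 \<and> c 5 = 0 \<or>
      c 2 = 1 \<and> c 3 = - 1 \<and> c 4 = 1 \<and> c 5 = - 1 \<or>
      c 2 = 1 \<and> c 3 = - 1 \<and> c 4 = 1 \<and> c 5 = 0 \<or>
      c 2 = 1 \<and> c 3 = 0 \<and> c 4 = 0 \<and> c 5 = 0 \<or>
      c 2 = 1 \<and> c 3 = 0 \<and> c 4 = 0 \<and> c 5 = 1"
    using c1 L4 b[of 5, simplified]
    by (elim disjE conjE; insert p; simp (asm_lr))
  note p =
    pos[of "[1, 1, 0, 0, 0, -1, -1]", simplified]
    pos[of "[1, 0, 0, 1, 0, 0, 1]", simplified]
    pos[of "[1, 0, -1, -1, 0, 1, 1]", simplified]
    pos[of "[1, 0, -1, 0, 1, 0, -1]", simplified]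
    pos[of "[1, 0, 0, -1, 0, 0, 1]", simplified]
    pos[of "[1, 1, 0, -1, 0, 1, 1]", simplified]
    pos[of "[1, 1, 1, 0, -1, -1, -1]", simplified]
    pos[of "[1, 1, 1, 1, 1, 1, 1]", simplified]
  have L6: "c 2 = 0 \<and> c 3 = 0 \<and> c 4 = 0 \<and> c 5 = 0 \<and> c 6 = 0 \<or>
      c 2 = 0 \<and> c 3 = 0 \<and> c 4 = 0 \<and> c 5 = 0 \<and> c 6 = 1 \<or>
      c 2 = 0 \<and> c 3 = 0 \<and> c 4 = 0 \<and> c 5 = 1 \<and> c 6 = - 1 \<or>
      c 2 = 0 \<and> c 3 = 0 \<and> c 4 = 1 \<and> c 5 = - 1 \<and> c 6 = 0 \<or>
      c 2 = 0 \<and> c 3 = 1 \<and> c 4 = - 1 \<and> c 5 = 0 \<and> c 6 = 1 \<or>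
      c 2 = 0 \<and> c 3 = 1 \<and> c 4 = - 1 \<and> c 5 = 1 \<and> c 6 = 0 \<or>
      c 2 = 1 \<and> c 3 = - 1 \<and> c 4 = 0 \<and> c 5 = 0 \<and> c 6 = 0 \<or>
      c 2 = 1 \<and> c 3 = - 1 \<and> c 4 = 1 \<and> c 5 = - 1 \<and> c 6 = 0 \<or>
      c 2 = 1 \<and> c 3 = - 1 \<and> c 4 = 1 \<and> c 5 = - 1 \<and> c 6 = 1 \<or>
      c 2 = 1 \<and> c 3 = - 1 \<and> c 4 = 1 \<and> c 5 = 0 \<and> c 6 = 0 \<or>
      c 2 = 1 \<and> c 3 = 0 \<and> c 4 = 0 \<and> c 5 = 0 \<and> c 6 = 0 \<or>
      c 2 = 1 \<and> c 3 = 0 \<and> c 4 = 0 \<and> c 5 = 1 \<and> c 6 = - 1"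
    using c1 L5 b[of 6, simplified]
    by (elim disjE conjE; insert p; simp (asm_lr))
  note p =
    pos[of "[1, 1, 0, 0, 0, 0, -1, -1]", simplified]
    pos[of "[1, 1, 0, -1, -1, 0, 1, 1]", simplified]
    pos[of "[1, 0, 0, 0, -1, 0, 0, -1]", simplified]
    pos[of "[1, 0, -1, 0, 0, 0, 1, 1]", simplified]
    pos[of "[1, 0, -1, 1, 1, -1, 0, 1]", simplified]
    pos[of "[1, 1, 1, 0, 0, -1, -1, -1]", simplified]
    pos[of "[1, 1, 0, 0, 0, 0, 1, 1]", simplified]
    pos[of "[1, 0, -1, 0, 1, 0, -1, -1]", simplified]
    pos[of "[1, 1, 1, 1, 1, 1, 1, 1]", simplified]
  have L7: "c 2 = 0 \<and> c 3 = 0 \<and> c 4 = 0 \<and> c 5 = 0 \<and> c 6 = 0 \<and> c 7 = 0 \<or>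
      c 2 = 0 \<and> c 3 = 0 \<and> c 4 = 0 \<and> c 5 = 0 \<and> c 6 = 0 \<and> c 7 = 1 \<or>
      c 2 = 0 \<and> c 3 = 0 \<and> c 4 = 0 \<and> c 5 = 0 \<and> c 6 = 1 \<and> c 7 = - 1 \<or>
      c 2 = 0 \<and> c 3 = 0 \<and> c 4 = 0 \<and> c 5 = 1 \<and> c 6 = - 1 \<and> c 7 = 0 \<or>
      c 2 = 0 \<and> c 3 = 0 \<and> c 4 = 1 \<and> c 5 = - 1 \<and> c 6 = 0 \<and> c 7 = 1 \<or>
      c 2 = 0 \<and> c 3 = 1 \<and> c 4 = - 1 \<and> c 5 = 0 \<and> c 6 = 1 \<and> c 7 = - 1 \<or>
      c 2 = 0 \<and> c 3 = 1 \<and> c 4 = - 1 \<and> c 5 = 1 \<and> c 6 = 0 \<and> c 7 = - 1 \<or>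
      c 2 = 1 \<and> c 3 = - 1 \<and> c 4 = 0 \<and> c 5 = 0 \<and> c 6 = 0 \<and> c 7 = 1 \<or>
      c 2 = 1 \<and> c 3 = - 1 \<and> c 4 = 1 \<and> c 5 = - 1 \<and> c 6 = 0 \<and> c 7 = 0 \<or>
      c 2 = 1 \<and> c 3 = - 1 \<and> c 4 = 1 \<and> c 5 = - 1 \<and> c 6 = 1 \<and> c 7 = - 1 \<or>
      c 2 = 1 \<and> c 3 = - 1 \<and> c 4 = 1 \<and> c 5 = - 1 \<and> c 6 = 1 \<and> c 7 = 0 \<or>
      c 2 = 1 \<and> c 3 = - 1 \<and> c 4 = 1 \<and> c 5 = 0 \<and> c 6 = 0 \<and> c 7 = 0 \<or>
      c 2 = 1 \<and> c 3 = 0 \<and> c 4 = 0 \<and> c 5 = 0 \<and> c 6 = 0 \<and> c 7 = 0 \<or>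
      c 2 = 1 \<and> c 3 = 0 \<and> c 4 = 0 \<and> c 5 = 1 \<and> c 6 = - 1 \<and> c 7 = 1"
    using c1 L6 b[of 7, simplified]
    by (elim disjE conjE; insert p; simp (asm_lr))
  note p =
    pos[of "[1, 1, 0, 0, 0, 0, 0, -1, -1]", simplified]
    pos[of "[1, 1, 0, 0, 0, 0, 0, 1, 1]", simplified]
    pos[of "[1, 0, 0, 0, -1, 0, 0, 0, 1]", simplified]
    pos[of "[1, 0, -1, 0, 0, 0, 1, 0, -1]", simplified]
    pos[of "[1, 0, -1, 0, 1, 0, -1, 0, 1]", simplified]
    pos[of "[1, 1, 0, -1, -1, -1, 0, 1, 1]", simplified]
    pos[of "[1, 1, 0, -1, 0, 1, 0, -1, -1]", simplified]
    pos[of "[1, 1, 1, 1, 0, -1, -1, -1, -1]", simplified]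
    pos[of "[1, 0, -1, 1, 0, -1, 1, 0, -1]", simplified]
    pos[of "[1, -1, 0, 1, -1, 1, 0, -1, 1]", simplified]
    pos[of "[1, 1, -1, -2, 0, 2, 1, -1, -1]", simplified]
    pos[of "[2, -1, -1, 1, -1, 1, -1, -1, 2]", simplified]
    pos[of "[1, 2, 2, 1, 0, -1, -2, -2, -1]", simplified]
    pos[of "[2, 3, 2, 1, 0, -1, -2, -3, -2]", simplified]
  \<comment> \<open>The zero pattern is not followed beyond \<open>c 7\<close>. The prefix ending in
    \<open>c 8 = 0\<close> falls only to vectors of length 10.\<close>
  have L8: "c 2 = 0 \<and> c 3 = 0 \<and> c 4 = 0 \<and> c 5 = 0 \<and> c 6 = 0 \<and> c 7 = 0 \<or>
      c 2 = 1 \<and> c 3 = - 1 \<and> c 4 = 1 \<and> c 5 = - 1 \<and> c 6 = 1 \<and> c 7 = - 1 \<and> c 8 = 0 \<or>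
      c 2 = 1 \<and> c 3 = - 1 \<and> c 4 = 1 \<and> c 5 = - 1 \<and> c 6 = 1 \<and> c 7 = - 1 \<and> c 8 = 1"
    using c1 L7 b[of 8, simplified]
    by (elim disjE conjE; insert p; simp (asm_lr))
  note p =
    pos[of "[2, -1, -1, 1, -1, 1, -1, 1, 1, -2]", simplified]
    pos[of "[1, 1, 0, 0, 0, 0, 0, 0, 1, 1]", simplified]
  have L9: "c 2 = 0 \<and> c 3 = 0 \<and> c 4 = 0 \<and> c 5 = 0 \<and> c 6 = 0 \<and> c 7 = 0 \<or>
      c 2 = 1 \<and> c 3 = - 1 \<and> c 4 = 1 \<and> c 5 = - 1 \<and> c 6 = 1 \<and> c 7 = - 1 \<and> c 8 = 1"
    using c1 L8 b[of 9, simplified]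
    by (elim disjE conjE; insert p; simp (asm_lr))
  have "{2..7} = {2, 3, 4, 5, 6, 7 :: nat}" "{1..8} = {1, 2, 3, 4, 5, 6, 7, 8 :: nat}" by auto
  thus ?thesis using L9 c1 by auto
qed

section \<open>Root lattices with an isometry\<close>

text \<open>Only absolute value 1 is asked of \<open>w i\<close>, so the same results serve the
  given roots, signed powers of them, and a change of base vector that alters the weights.\<close>

locale root_weights =
  fixes I :: "nat set" and \<gamma> :: "nat \<Rightarrow> real" and w :: "nat \<Rightarrow> complex"
  assumes finite_I: "finite I"
    and pos: "\<And>i. i \<in> I \<Longrightarrow> \<gamma> i > 0"
    and norm_w: "\<And>i. i \<in> I \<Longrightarrow> cmod (w i) = 1"
    and total: "(\<Sum>i\<in>I. \<gamma> i) = 1"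
    and integral: "\<And>k. 2 * (\<Sum>i\<in>I. \<gamma> i * Re (w i ^ k)) \<in> \<int>"
begin

definition c :: "nat \<Rightarrow> int" where
  "c k = \<lfloor>2 * (\<Sum>i\<in>I. \<gamma> i * Re (w i ^ k))\<rfloor>"

lemma c_eq: "of_int (c k) = 2 * (\<Sum>i\<in>I. \<gamma> i * Re (w i ^ k))"
  unfolding c_def using integral[of k] by (rule of_int_floor)

lemma c_0: "c 0 = 2"
  using c_eq[of 0] total by simp

lemma cnj_w: "i \<in> I \<Longrightarrow> w i * cnj (w i) = 1"
  using norm_w[of i] by (simp flip: complex_norm_square)

text \<open>The form lives on all coordinate families; a lattice element enters through its values
  at the \<open>w i\<close>. The factor 2 gives powers of \<open>w\<close> norm 2.\<close>

definition ip :: "(nat \<Rightarrow> complex) \<Rightarrow> (nat \<Rightarrow> complex) \<Rightarrow> real" where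
  "ip u v = 2 * (\<Sum>i\<in>I. \<gamma> i * Re (u i * cnj (v i)))"

lemma ip_commute: "ip u v = ip v u"
  by (simp add: ip_def algebra_simps)

lemma ip_add_left: "ip (\<lambda>i. u i + u' i) v = ip u v + ip u' v"
  by (simp add: ip_def algebra_simps sum.distrib)

lemma ip_sum_left: "ip (\<lambda>i. \<Sum>j\<in>A. of_real (a j) * u j i) v = (\<Sum>j\<in>A. a j * ip (u j) v)"
proof -
  have "ip (\<lambda>i. \<Sum>j\<in>A. of_real (a j) * u j i) v =
      2 * (\<Sum>i\<in>I. \<Sum>j\<in>A. a j * (\<gamma> i * Re (u j i * cnj (v i))))"
    by (simp add: ip_def sum_distrib_right sum_distrib_left algebra_simps)
  also have "\<dots> = 2 * (\<Sum>j\<in>A. \<Sum>i\<in>I. a j * (\<gamma> i * Re (u j i * cnj (v i))))"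
    by (subst sum.swap) simp
  also have "\<dots> = (\<Sum>j\<in>A. a j * ip (u j) v)"
    by (simp add: ip_def sum_distrib_left mult_ac)
  finally show ?thesis .
qed

lemma ip_self: "ip u u = 2 * (\<Sum>i\<in>I. \<gamma> i * (cmod (u i))\<^sup>2)"
  by (simp add: ip_def complex_mult_cnj cmod_power2)

lemma ip_self_nonneg: "ip u u \<ge> 0"
  unfolding ip_self using pos by (intro mult_nonneg_nonneg sum_nonneg) (auto simp: less_imp_le)

lemma ip_self_eq_0:
  assumes "ip u u = 0" "i \<in> I"
  shows "u i = 0"
proof -
  have "(\<Sum>i\<in>I. \<gamma> i * (cmod (u i))\<^sup>2) = 0" using assms by (simp add: ip_self)
  hence "\<gamma> i * (cmod (u i))\<^sup>2 = 0"
    using finite_I pos assms(2) by (subst (asm) sum_nonneg_eq_0_iff) (auto simp: less_imp_le)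
  thus ?thesis using pos[OF assms(2)] by simp
qed

lemma ip_cauchy_schwarz:
  assumes "ip v v > 0"
  shows "(ip u v)\<^sup>2 \<le> ip u u * ip v v"
proof -
  define a b where "a = ip u v" and "b = ip v v"
  \<comment> \<open>This is \<open>b\<close> times the component of \<open>u\<close> orthogonal to
    \<open>v\<close>.\<close>
  define x where "x = (\<lambda>i. of_real b * u i + of_real (- a) * v i)"
  have lin: "ip (\<lambda>i. of_real r * u i + of_real s * v i) t = r * ip u t + s * ip v t" for r s t
    by (simp add: ip_def algebra_simps sum.distrib sum_distrib_left)
  have "ip x x = b * ip u x - a * ip v x" unfolding x_def by (subst lin) simp
  also have "ip u x = b * ip u u - a * ip u v"
    unfolding x_def by (subst ip_commute, subst lin) (simp add: ip_commute)
  also have "ip v x = b * ip u v - a * ip v v"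
    unfolding x_def by (subst ip_commute, subst lin) simp
  finally have "ip x x = b * (ip u u * b - a\<^sup>2)"
    by (simp add: a_def b_def algebra_simps power2_eq_square)
  hence "b * (ip u u * b - a\<^sup>2) \<ge> 0" using ip_self_nonneg[of x] by simp
  thus ?thesis using assms by (simp add: a_def b_def zero_le_mult_iff)
qed

abbreviation pw :: "nat \<Rightarrow> nat \<Rightarrow> complex" where
  "pw k \<equiv> \<lambda>i. w i ^ k"

lemma ip_pw: "ip (pw a) (pw b) = of_int (c (if a \<le> b then b - a else a - b))"
proof -
  have *: "Re (w i ^ a * cnj (w i ^ b)) = Re (w i ^ (b - a))" if "a \<le> b" "i \<in> I" for a b i
  proof -
    have "w i ^ a * cnj (w i ^ b) = (w i * cnj (w i)) ^ a * cnj (w i) ^ (b - a)"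
      using that by (simp add: power_mult_distrib mult.assoc flip: power_add)
    also have "\<dots> = cnj (w i ^ (b - a))" using cnj_w[OF that(2)] by simp
    finally show ?thesis by (simp only: cnj.sel)
  qed
  have le: "ip (pw a) (pw b) = of_int (c (b - a))" if "a \<le> b" for a b
    unfolding ip_def c_eq using that by (intro arg_cong[of _ _ "(*) 2"] sum.cong) (simp_all only: *)
  show ?thesis using le[of a b] le[of b a] ip_commute[of "pw a" "pw b"] by auto
qed

lemma c_bound: "\<bar>c k\<bar> \<le> 2"
proof -
  have "\<bar>\<Sum>i\<in>I. \<gamma> i * Re (w i ^ k)\<bar> \<le> (\<Sum>i\<in>I. \<gamma> i)"
  proof (rule order.trans[OF sum_abs], rule sum_mono)
    fix i assume i: "i \<in> I"
    have "\<bar>Re (w i ^ k)\<bar> \<le> 1"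
      using abs_Re_le_cmod[of "w i ^ k"] norm_w[OF i] by (simp add: norm_power)
    thus "\<bar>\<gamma> i * Re (w i ^ k)\<bar> \<le> \<gamma> i"
      using pos[OF i] mult_left_le[of "\<bar>Re (w i ^ k)\<bar>" "\<gamma> i"] by (simp add: abs_mult)
  qed
  hence "\<bar>real_of_int (c k)\<bar> \<le> 2" using total by (simp add: c_eq)
  thus ?thesis by linarith
qed

text \<open>The vector \<open>w ^ k - e\<close> has norm \<open>4 - 2 * e * c k = 0\<close>, and the
  weights are positive.\<close>

lemma c_extreme:
  assumes "c k = 2 * e" "\<bar>e\<bar> = 1" "i \<in> I"
  shows "w i ^ k = of_int e"
proof -
  have e: "e = 1 \<or> e = - 1" using assms(2) by linarith
  define u where "u = (\<lambda>i. w i ^ k - of_int e)"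
  have u: "(cmod (u j))\<^sup>2 = 2 - 2 * e * Re (w j ^ k)" if "j \<in> I" for j
  proof -
    have "(Re (w j ^ k))\<^sup>2 + (Im (w j ^ k))\<^sup>2 = 1"
      using norm_w[OF that] by (simp add: norm_power flip: cmod_power2)
    thus ?thesis using e unfolding u_def cmod_power2 by (auto simp: power2_eq_square algebra_simps)
  qed
  have "ip u u = 2 * (\<Sum>j\<in>I. \<gamma> j * (2 - 2 * e * Re (w j ^ k)))"
    unfolding ip_self by (intro arg_cong[of _ _ "(*) 2"] sum.cong) (simp_all add: u)
  also have "\<dots> = 4 * (\<Sum>j\<in>I. \<gamma> j) - 2 * e * (2 * (\<Sum>j\<in>I. \<gamma> j * Re (w j ^ k)))"
    by (simp add: algebra_simps sum_subtractf sum_distrib_left sum_distrib_right)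
  also have "\<dots> = 0" using e assms(1) by (auto simp: total simp flip: c_eq)
  finally have "u i = 0" using assms(3) by (rule ip_self_eq_0)
  thus ?thesis by (simp add: u_def)
qed

lemma c_cong:
  assumes "\<And>i. i \<in> I \<Longrightarrow> Re (w i ^ k) = of_int e * Re (w i ^ l)"
  shows "c k = e * c l"
proof -
  have "real_of_int (c k) = of_int (e * c l)"
    unfolding c_eq of_int_mult using assms by (simp add: sum_distrib_left mult_ac)
  thus ?thesis by linarith
qed

lemma toeplitz_row_eq:
  "of_int (toeplitz_row c xs k) = 2 * (\<Sum>i\<in>I. \<gamma> i * Re (w i ^ k * ipoly (Poly xs) (w i)))"
proof (induction xs arbitrary: k)
  case (Cons x xs)
  have "of_int (toeplitz_row c (x # xs) k) =
      of_int x * (2 * (\<Sum>i\<in>I. \<gamma> i * Re (w i ^ k))) +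
      2 * (\<Sum>i\<in>I. \<gamma> i * Re (w i ^ (k + 1) * ipoly (Poly xs) (w i)))"
    using Cons[of "k + 1"] by (simp add: c_eq)
  also have "\<dots> = 2 * (\<Sum>i\<in>I. \<gamma> i * Re (w i ^ k * ipoly (Poly (x # xs)) (w i)))"
    by (simp add: sum_distrib_left algebra_simps flip: sum.distrib)
  finally show ?case .
qed simp

lemma toeplitz_form_eq:
  "of_int (toeplitz_form c xs) = (\<Sum>i\<in>I. \<gamma> i * (cmod (ipoly (Poly xs) (w i)))\<^sup>2)"
proof (induction xs)
  case (Cons x xs)
  have expand: "(cmod (ipoly (Poly (x # xs)) (w i)))\<^sup>2 =
      (of_int x)\<^sup>2 + of_int x * (2 * Re (w i * ipoly (Poly xs) (w i))) + (cmod (ipoly (Poly xs) (w i)))\<^sup>2"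
    if "i \<in> I" for i
  proof -
    have "(cmod (of_int x + y))\<^sup>2 = (of_int x)\<^sup>2 + of_int x * (2 * Re y) + (cmod y)\<^sup>2" for y
      unfolding cmod_power2 by (simp add: power2_eq_square algebra_simps)
    from this[of "w i * ipoly (Poly xs) (w i)"] norm_w[OF that] show ?thesis
      by (simp add: norm_mult)
  qed
  have "of_int (toeplitz_form c (x # xs)) =
      (of_int x)\<^sup>2 * (\<Sum>i\<in>I. \<gamma> i) +
      of_int x * (2 * (\<Sum>i\<in>I. \<gamma> i * Re (w i * ipoly (Poly xs) (w i)))) +
      (\<Sum>i\<in>I. \<gamma> i * (cmod (ipoly (Poly xs) (w i)))\<^sup>2)"
    using Cons by (simp add: toeplitz_row_eq total)
  also have "\<dots> = (\<Sum>i\<in>I. \<gamma> i * (cmod (ipoly (Poly (x # xs)) (w i)))\<^sup>2)"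
    by (simp add: expand sum_distrib_left sum_distrib_right distrib_left mult_ac sum.distrib del: Poly.simps)
  finally show ?case .
qed simp

lemma toeplitz_form_pos:
  assumes "i \<in> I" "ipoly (Poly xs) (w i) \<noteq> 0"
  shows "toeplitz_form c xs > 0"
proof -
  have "(\<Sum>i\<in>I. \<gamma> i * (cmod (ipoly (Poly xs) (w i)))\<^sup>2) > 0"
    using assms pos finite_I by (intro sum_pos2[of I i]) (auto simp: less_imp_le)
  hence "real_of_int (toeplitz_form c xs) > 0" by (simp only: toeplitz_form_eq)
  thus ?thesis by simp
qed

text \<open>
  If \<open>s\<close> is the first index \<open>\<ge> 2\<close> with \<open>c s \<noteq> 0\<close>, then \<open>1, w, \<dots>, w\<^sup>s\<close> generate the affine root
  lattice \<open>A\<^sub>s\<close> (\<open>c s = - 1\<close>, whence \<open>1 + w + \<dots> + w\<^sup>s = 0\<close>) or the root lattice of type \<open>D\<close> and rank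
  \<open>s + 1\<close> (\<open>c s = 1\<close>). In the latter case \<open>\<Sum> (s + 1 - 2 j) w\<^sup>j\<close> is a signed sum of twice an
  orthonormal frame, and Cauchy-Schwarz against \<open>1 + w\<^sup>s\<^sup>+\<^sup>1\<close> leaves only \<open>w\<^sup>s\<^sup>+\<^sup>1 = - 1\<close>.
\<close>
lemma first_gap:
  assumes c1: "c 1 = - 1" and gap: "\<And>k. 2 \<le> k \<Longrightarrow> k < s \<Longrightarrow> c k = 0"
    and s: "s \<ge> 8" "c s \<noteq> 0"
  shows "\<exists>e. \<bar>e\<bar> = 1 \<and> (\<forall>i\<in>I. w i ^ (s + 1) = of_int e)"
proof -
  define dist where "dist = (\<lambda>k j :: nat. if k \<le> j then j - k else k - j)"
  have ip_comb: "ip (pw k) (\<lambda>i. \<Sum>j\<in>{..s}. of_real (a j) * pw j i) = (\<Sum>j\<le>s. a j * c (dist k j))" for a k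
    by (subst ip_commute, subst ip_sum_left) (auto simp: ip_pw dist_def intro!: sum.cong)
  \<comment> \<open>By \<open>gap\<close> only index distances 0, 1, \<open>s\<close> and
    \<open>s + 1\<close> can contribute, so this and the following sums have at most three nonzero
    terms.\<close>
  have ip_0: "(\<Sum>j\<le>s. a j * c (dist 0 j)) = 2 * a 0 - a 1 + a s * c s" for a :: "nat \<Rightarrow> real"
  proof -
    have "(\<Sum>j\<le>s. a j * c (dist 0 j)) = (\<Sum>j\<in>{0, 1, s}. a j * c (dist 0 j))"
    proof (rule sum.mono_neutral_right, simp, use s in simp, rule ballI)
      fix j assume "j \<in> {..s} - {0, 1, s}"
      thus "a j * c (dist 0 j) = 0" using gap[of j] by (simp add: dist_def)
    qed
    thus ?thesis using s c1 c_0 by (simp add: dist_def)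
  qed
  have ip_mid: "(\<Sum>j\<le>s. a j * c (dist k j)) = 2 * a k - a (k - 1) - a (k + 1)"
    if k: "1 \<le> k" "k < s" for k and a :: "nat \<Rightarrow> real"
  proof -
    have "(\<Sum>j\<le>s. a j * c (dist k j)) = (\<Sum>j\<in>{k - 1, k, k + 1}. a j * c (dist k j))"
    proof (rule sum.mono_neutral_right, simp, use k in simp, rule ballI)
      fix j assume "j \<in> {..s} - {k - 1, k, k + 1}"
      hence "2 \<le> dist k j" "dist k j < s" using k by (simp_all add: dist_def, linarith+)
      thus "a j * c (dist k j) = 0" using gap by simp
    qed
    thus ?thesis using k c1 c_0 by (cases k) (auto simp: dist_def)
  qed
  have ip_s: "(\<Sum>j\<le>s. a j * c (dist s j)) = a 0 * c s - a (s - 1) + 2 * a s" for a :: "nat \<Rightarrow> real"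
  proof -
    have "(\<Sum>j\<le>s. a j * c (dist s j)) = (\<Sum>j\<in>{0, s - 1, s}. a j * c (dist s j))"
    proof (rule sum.mono_neutral_right, simp, use s in simp, rule ballI)
      fix j assume "j \<in> {..s} - {0, s - 1, s}"
      hence "2 \<le> dist s j" "dist s j < s" by (simp_all add: dist_def, linarith+)
      thus "a j * c (dist s j) = 0" using gap by simp
    qed
    thus ?thesis using s c1 c_0 by (auto simp: dist_def)
  qed
  have ip_Suc: "(\<Sum>j\<le>s. a j * c (dist (s + 1) j)) = a 0 * c (s + 1) + a 1 * c s - a s" for a :: "nat \<Rightarrow> real"
  proof -
    have "(\<Sum>j\<le>s. a j * c (dist (s + 1) j)) = (\<Sum>j\<in>{0, 1, s}. a j * c (dist (s + 1) j))"
    proof (rule sum.mono_neutral_right, simp, use s in simp, rule ballI)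
      fix j assume "j \<in> {..s} - {0, 1, s}"
      hence "2 \<le> dist (s + 1) j" "dist (s + 1) j < s" by (simp_all add: dist_def, linarith+)
      thus "a j * c (dist (s + 1) j) = 0" using gap by simp
    qed
    thus ?thesis using s c1 c_0 by (auto simp: dist_def)
  qed
  have "c (s - 1) = 0" using gap[of "s - 1"] s by simp
  \<comment> \<open>Otherwise \<open>w ^ s\<close> is a sign and \<open>c (s - 1)\<close> equals
    \<open>c 1\<close> up to sign, although it lies in the gap.\<close>
  have "\<bar>c s\<bar> \<noteq> 2"
  proof
    assume "\<bar>c s\<bar> = 2"
    then obtain e where e: "c s = 2 * e" "\<bar>e\<bar> = 1"
      by (metis abs_mult abs_numeral abs_sgn mult.commute mult_cancel_left1 mult_sgn_abs)
    have "c (s - 1) = e * c 1"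
    proof (rule c_cong)
      fix i assume i: "i \<in> I"
      have "w i ^ (s - 1) = w i ^ (s - 1) * (w i * cnj (w i))" using cnj_w[OF i] by simp
      also have "\<dots> = w i ^ s * cnj (w i)"
        using s by (simp add: mult.assoc[symmetric] flip: power_Suc2)
      also have "w i ^ s = of_int e" using c_extreme[OF e i] .
      finally show "Re (w i ^ (s - 1)) = of_int e * Re (w i ^ 1)" by simp
    qed
    thus False using \<open>c (s - 1) = 0\<close> e c1 by simp
  qed
  hence "c s = 1 \<or> c s = - 1" using s c_bound[of s] by linarith
  thus ?thesis
  proof
    assume cs: "c s = - 1"
    define S where "S = (\<lambda>i. \<Sum>j\<in>{..s}. of_real 1 * pw j i)"
    have "ip (pw k) S = 0" if "k \<le> s" for k
    proof -
      have "(\<Sum>j\<le>s. 1 * real_of_int (c (dist k j))) = 0"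
      proof (cases "k = 0 \<or> k = s")
        case True
        thus ?thesis using ip_0[of "\<lambda>_. 1"] ip_s[of "\<lambda>_. 1"] cs by auto
      next
        case False
        thus ?thesis using ip_mid[of k "\<lambda>_. 1"] that by auto
      qed
      thus ?thesis unfolding S_def ip_comb[of k "\<lambda>_. 1"] .
    qed
    hence "ip S S = 0" by (subst (1) S_def, subst ip_sum_left) simp
    hence "w i ^ (s + 1) = of_int 1" if "i \<in> I" for i
      using ip_self_eq_0[OF _ that, of S] power_diff_1_eq[of "w i" "s + 1"]
      by (auto simp: S_def lessThan_Suc_atMost)
    thus ?thesis by (intro exI[of _ 1]) simp
  next
    assume cs: "c s = 1"
    \<comment> \<open>Affine coefficients have zero second differences, and these also satisfy the
      end condition at \<open>s\<close>: \<open>F\<close> is orthogonal to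
      \<open>w, ..., w ^ s\<close> and pairs to 4 with 1.\<close>
    define a where "a = (\<lambda>j. real s + 1 - 2 * real j)"
    define F where "F = (\<lambda>i. \<Sum>j\<in>{..s}. of_real (a j) * pw j i)"
    define g where "g = (\<lambda>i. pw 0 i + pw (s + 1) i)"
    have F_0: "ip (pw 0) F = 4"
      unfolding F_def ip_comb ip_0 using cs by (simp add: a_def)
    have "ip (pw k) F = 0" if "k \<in> {1..s}" for k
    proof (cases "k = s")
      case True
      thus ?thesis unfolding F_def ip_comb using ip_s[of a] cs s by (simp add: a_def of_nat_diff)
    next
      case False
      thus ?thesis unfolding F_def ip_comb using ip_mid[of k a] that by (simp add: a_def of_nat_diff)
    qed
    moreover have "{..s} = insert 0 {1..s}" by auto
    ultimately have FF: "ip F F = 4 * (real s + 1)"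
      by (subst (1) F_def, subst ip_sum_left) (simp add: F_0[simplified] a_def)
    have "ip (pw (s + 1)) F = (real s + 1) * c (s + 1) + 2 * (real s - 1)"
      unfolding F_def ip_comb ip_Suc using cs by (simp add: a_def algebra_simps)
    hence gF: "ip g F = (real s + 1) * (c (s + 1) + 2)"
      unfolding g_def ip_add_left F_0 by (simp add: algebra_simps)
    have gv: "ip g v = ip (pw 0) v + ip (pw (s + 1)) v" for v unfolding g_def by (rule ip_add_left)
    have gg: "ip g g = 2 * (c (s + 1) + 2)"
      by (subst gv, subst (1 2) ip_commute, subst (1 2) gv, simp only: ip_pw) (simp add: c_0)
    have "((real s + 1) * (c (s + 1) + 2))\<^sup>2 \<le> 2 * (c (s + 1) + 2) * (4 * (real s + 1))"
      using ip_cauchy_schwarz[of F g] FF unfolding gF gg by simp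
    hence upper: "(real s + 1) * (c (s + 1) + 2) * ((real s + 1) * (c (s + 1) + 2) - 8) \<le> 0"
      by (simp add: power2_eq_square algebra_simps)
    \<comment> \<open>For \<open>t = (s + 1) * (c (s + 1) + 2)\<close> the bound reads
      \<open>t * (t - 8) \<le> 0\<close>, while \<open>s \<ge> 8\<close> would give
      \<open>t \<ge> 9\<close>.\<close>
    have "\<not> c (s + 1) \<ge> - 1"
    proof
      assume that: "c (s + 1) \<ge> - 1"
      have "(real s + 1) * (c (s + 1) + 2) \<ge> 9 * 1"
        using that s by (intro mult_mono) auto
      hence "(real s + 1) * (c (s + 1) + 2) * ((real s + 1) * (c (s + 1) + 2) - 8) > 0"
        using that by (intro mult_pos_pos) auto
      thus False using upper by linarith
    qed
    hence "c (s + 1) = 2 * - 1" using c_bound[of "s + 1"] by linarith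
    hence "w i ^ (s + 1) = of_int (- 1)" if "i \<in> I" for i using that by (intro c_extreme) auto
    thus ?thesis by (intro exI[of _ "- 1"]) simp
  qed
qed

section \<open>Exclusion of the two surviving patterns\<close>

lemma c_sum:
  assumes "\<And>i. i \<in> I \<Longrightarrow> (\<Sum>j\<in>A. w i ^ h j) = 0"
  shows "(\<Sum>j\<in>A. c (h j)) = 0"
proof -
  have "real_of_int (\<Sum>j\<in>A. c (h j)) = 2 * (\<Sum>j\<in>A. \<Sum>i\<in>I. \<gamma> i * Re (w i ^ h j))"
    by (simp add: c_eq sum_distrib_left)
  also have "\<dots> = 2 * (\<Sum>i\<in>I. \<gamma> i * Re (\<Sum>j\<in>A. w i ^ h j))"
    by (subst sum.swap) (simp add: sum_distrib_left)
  also have "\<dots> = 0" using assms by simp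
  finally show ?thesis by linarith
qed

text \<open>With \<open>s\<close> the first index beyond 1 where \<open>c\<close> is nonzero,
  \<open>c\<close> vanishes off the residues 0, 1, \<open>s\<close> modulo \<open>s + 1\<close>. The
  exponents \<open>2 * (q * j)\<close> with \<open>0 < j < p\<close> avoid these residues, so a
  vanishing sum reduces to \<open>c 0 = 2\<close>.\<close>

lemma path_contradiction:
  assumes c1: "c 1 = - 1" and path: "\<And>k. k \<in> {2..7} \<Longrightarrow> c k = 0"
    and pq: "prime p" "odd p" "q > 1"
    and prim: "\<And>i. i \<in> I \<Longrightarrow> primitive_root_of_unity (p * q) ((w i)\<^sup>2)"
  shows False
proof -
  define m where "m = p * q"
  have p: "p \<ge> 2" using pq(1) by (rule prime_ge_2_nat)
  have m: "m \<ge> 4" using mult_mono[of 2 p 2 q] p pq(3) by (simp add: m_def)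
  obtain i0 where i0: "i0 \<in> I" using total by (cases "I = {}") auto
  have wm: "w i ^ (2 * m) = 1" if "i \<in> I" for i
    using prim[OF that] by (simp add: power_mult primitive_root_of_unity_def m_def)
  \<comment> \<open>Periodicity repeats \<open>c 1\<close> at this index, so \<open>s\<close>
    exists.\<close>
  have "c (2 * m - 1) = 1 * c 1"
  proof (rule c_cong)
    fix i assume i: "i \<in> I"
    have "w i ^ (2 * m - 1) = w i ^ (2 * m - 1) * (w i * cnj (w i))" using cnj_w[OF i] by simp
    also have "\<dots> = w i ^ (2 * m) * cnj (w i)"
      using m by (simp add: mult.assoc[symmetric] flip: power_Suc2)
    finally show "Re (w i ^ (2 * m - 1)) = of_int 1 * Re (w i ^ 1)" by (simp add: wm[OF i])
  qed
  hence ex: "2 * m - 1 \<ge> 2 \<and> c (2 * m - 1) \<noteq> 0" using m c1 by simp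
  define s where "s = (LEAST k. k \<ge> 2 \<and> c k \<noteq> 0)"
  have s: "s \<ge> 2" "c s \<noteq> 0" using LeastI[where P = "\<lambda>k. k \<ge> 2 \<and> c k \<noteq> 0", OF ex] by (auto simp: s_def)
  have gap: "c k = 0" if "2 \<le> k" "k < s" for k using that not_less_Least[of k] by (auto simp: s_def)
  have "s \<ge> 8" using path[of s] s by (cases "s \<le> 7") auto
  from first_gap[OF c1 gap this s(2)] obtain e where e: "\<bar>e\<bar> = 1" "\<And>i. i \<in> I \<Longrightarrow> w i ^ (s + 1) = of_int e"
    by auto
  have zero: "c k = 0" if "2 \<le> k mod (s + 1)" "k mod (s + 1) < s" for k
  proof -
    have "c k = e ^ (k div (s + 1)) * c (k mod (s + 1))"
    proof (rule c_cong)
      fix i assume "i \<in> I"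
      have "w i ^ k = (w i ^ (s + 1)) ^ (k div (s + 1)) * w i ^ (k mod (s + 1))"
        by (simp only: mult_div_mod_eq flip: power_mult power_add)
      also have "w i ^ (s + 1) = of_int e" using e(2) \<open>i \<in> I\<close> .
      finally have "w i ^ k = of_real (of_int (e ^ (k div (s + 1)))) * w i ^ (k mod (s + 1))" by simp
      thus "Re (w i ^ k) = of_int (e ^ (k div (s + 1))) * Re (w i ^ (k mod (s + 1)))"
        by (simp del: of_int_power)
    qed
    thus ?thesis using gap that by simp
  qed
  \<comment> \<open>Squaring removes the sign \<open>e\<close>: \<open>u\<close> has order
    \<open>m\<close>, yet \<open>u ^ (s + 1) = 1\<close>.\<close>
  define u where "u = (w i0)\<^sup>2"
  have u1: "u ^ k = 1 \<longleftrightarrow> m dvd k" for k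
    using primitive_root_power_eq_1_iff[OF prim[OF i0]] by (simp add: u_def m_def)
  have "u ^ (s + 1) = (w i0 ^ (s + 1))\<^sup>2" unfolding u_def by (simp only: mult.commute flip: power_mult)
  also have "\<dots> = of_int (e\<^sup>2)" using e(2)[OF i0] by simp
  also have "e\<^sup>2 = 1" using e(1) by (metis power2_abs power_one)
  finally have us: "u ^ (s + 1) = 1" by simp
  \<comment> \<open>As \<open>u ^ s\<close> inverts \<open>u\<close>, either case would give
    \<open>u ^ p = 1\<close>. This excludes the residues 1 and \<open>s\<close>, because
    \<open>u ^ (2 * (q * j))\<close> has trivial \<open>p\<close>-th power.\<close>
  have um: "u ^ (p * k) \<noteq> 1" if "k \<in> {1, s}" for k
  proof
    assume *: "u ^ (p * k) = 1"
    have "u ^ p = 1"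
    proof (cases "k = 1")
      case False
      hence "u ^ (p * k) * u ^ p = (u ^ (s + 1)) ^ p"
        using that by (simp add: power_mult_distrib mult.commute flip: power_mult)
      thus ?thesis using * us by simp
    qed (use * in simp)
    hence "p * q dvd p * 1" using u1 by (simp add: m_def)
    thus False using p pq(3) by (subst (asm) nat_mult_dvd_cancel1) auto
  qed
  have "c (2 * (q * j)) = 0" if j: "j \<in> {1..<p}" for j
  proof (rule zero)
    define r where "r = 2 * (q * j) mod (s + 1)"
    have ur: "u ^ r = u ^ (2 * (q * j))"
    proof -
      have "u ^ (2 * (q * j)) = (u ^ (s + 1)) ^ (2 * (q * j) div (s + 1)) * u ^ r"
        unfolding r_def by (simp only: mult_div_mod_eq flip: power_mult power_add)
      thus ?thesis using us by simp
    qed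
    have "r \<noteq> 0"
    proof
      assume "r = 0"
      hence "p * q dvd 2 * (q * j)" using ur u1 by (simp add: m_def)
      hence "q * p dvd q * (2 * j)" by (simp add: mult_ac)
      hence "p dvd 2 * j" using pq(3) by (subst (asm) nat_mult_dvd_cancel1) auto
      hence "p dvd 2 \<or> p dvd j" using pq(1) by (simp add: prime_dvd_mult_iff)
      moreover have "p \<noteq> 2" using pq(2) by auto
      ultimately show False using j p by (auto dest!: dvd_imp_le)
    qed
    moreover have "r \<notin> {1, s}"
    proof
      assume "r \<in> {1, s}"
      moreover have "u ^ (p * r) = 1"
      proof -
        have "u ^ (p * r) = (u ^ r) ^ p" by (simp only: mult.commute flip: power_mult)
        also have "\<dots> = u ^ (m * (2 * j))" unfolding ur m_def by (simp only: mult_ac flip: power_mult)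
        also have "\<dots> = 1" using u1 by simp
        finally show ?thesis .
      qed
      ultimately show False using um by blast
    qed
    moreover have "r < s + 1" by (simp add: r_def)
    ultimately show "2 \<le> 2 * (q * j) mod (s + 1)" "2 * (q * j) mod (s + 1) < s"
      unfolding r_def[symmetric] by auto
  qed
  moreover have "(\<Sum>j<p. c (2 * (q * j))) = 0"
  proof (rule c_sum)
    fix i assume i: "i \<in> I"
    have "((w i)\<^sup>2) ^ q \<noteq> 1"
    proof
      assume "((w i)\<^sup>2) ^ q = 1"
      hence "q * p dvd q * 1"
        using primitive_root_power_eq_1_iff[OF prim[OF i]] by (simp add: mult.commute)
      thus False using p pq(3) by (subst (asm) nat_mult_dvd_cancel1) auto
    qed
    moreover have "(((w i)\<^sup>2) ^ q) ^ p = 1"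
      using wm[OF i] by (simp add: m_def mult_ac flip: power_mult)
    ultimately have "(\<Sum>j<p. (((w i)\<^sup>2) ^ q) ^ j) = 0" by (rule sum_powers_root_of_unity[rotated])
    thus "(\<Sum>j<p. w i ^ (2 * (q * j))) = 0" by (simp add: mult_ac flip: power_mult)
  qed
  moreover have "{..<p} = insert 0 {1..<p}" using p by auto
  ultimately show False using c_0 by simp
qed

text \<open>Normalising \<open>c 1\<close> to \<open>- 1\<close> costs a sign, so only
  \<open>e * w i\<close> is known to have order \<open>p * q\<close>; since \<open>p * q\<close> is
  odd, so has \<open>(w i)\<^sup>2\<close>.\<close>

lemma no_weights_of_c1:
  assumes c1: "c 1 = - 1" and p: "prime p" "odd p" and q: "odd q" "q > 1"
    and large: "totient (p * q) > 10"
    and prim: "\<And>i. i \<in> I \<Longrightarrow> primitive_root_of_unity (p * q) (of_int e * w i)" and e: "\<bar>e\<bar> = 1"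
  shows False
proof -
  have e2: "e * e = 1" using e by (metis abs_mult_self_eq mult_1)
  hence e2': "of_int e * (of_int e * x) = (x :: complex)" for x
    by (metis mult.assoc mult_1 of_int_1 of_int_mult)
  obtain i0 where i0: "i0 \<in> I" using total by (cases "I = {}") auto
  have square: "primitive_root_of_unity (p * q) ((w i)\<^sup>2)" if i: "i \<in> I" for i
  proof -
    have "(w i)\<^sup>2 = (of_int e * w i)\<^sup>2"
      using e2'[of "w i"] by (simp add: power2_eq_square mult_ac)
    hence "((w i)\<^sup>2) ^ k = (of_int e * w i) ^ (2 * k)" for k by (simp only: power_mult)
    hence "((w i)\<^sup>2) ^ k = 1 \<longleftrightarrow> p * q dvd 2 * k" for k
      using primitive_root_power_eq_1_iff[OF prim[OF i]] by simp
    moreover have "p * q dvd 2 * k \<longleftrightarrow> p * q dvd k" for k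
      using p(2) q(1) by (intro coprime_dvd_mult_right_iff) simp
    moreover have "p * q > 0" using p q prime_gt_0_nat by simp
    ultimately show ?thesis by (auto simp: primitive_root_of_unity_def dest: dvd_imp_le)
  qed
  \<comment> \<open>A nonzero list of length at most 10 cannot vanish at \<open>w i0\<close>:
    substituting \<open>e * x\<close> for \<open>x\<close> would give \<open>e * w i0\<close> an
    equation of degree below its totient bound.\<close>
  have "toeplitz_form c xs > 0" if xs: "length xs \<le> 10" "\<exists>x\<in>set xs. x \<noteq> 0" for xs
  proof (rule toeplitz_form_pos[OF i0], rule notI)
    define P where "P = pcompose (Poly xs) [:0, e:]"
    assume "ipoly (Poly xs) (w i0) = 0"
    moreover have "ipoly [:0, e:] (of_int e * w i0) = w i0"
      using e2'[of "w i0"] by (simp add: mult_ac)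
    ultimately have "ipoly P (of_int e * w i0) = 0"
      by (simp only: P_def ipoly_pcompose)
    moreover have "P \<noteq> 0"
    proof
      assume "P = 0"
      moreover have "degree [:0, e:] > 0" using e by auto
      ultimately have "Poly xs = 0" unfolding P_def by (rule pcompose_eq_0)
      then obtain n where "xs = replicate n 0" unfolding Poly_eq_0 by blast
      thus False using xs(2) by simp
    qed
    ultimately have "totient (p * q) \<le> degree P"
      by (intro totient_le_degree[OF prim[OF i0]])
    also have "\<dots> \<le> length xs"
      using degree_Poly[of xs] e by (auto simp: P_def degree_pcompose)
    finally show False using large xs(1) by simp
  qed
  from toeplitz_prefix[OF this c1] show False
  proof
    assume "\<forall>k\<in>{2..7}. c k = 0"
    thus False using path_contradiction[OF c1 _ p q(2) square] by blast
  next
    assume alt: "\<forall>k\<in>{1..8}. c k = (- 1) ^ k"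
    \<comment> \<open>multiplying \<open>\<gamma>\<close> by \<open>|1 + w|\<^sup>2\<close> makes \<open>1 + w\<close> the base vector\<close>
    define \<gamma>' where "\<gamma>' = (\<lambda>i. \<gamma> i * (cmod (1 + w i))\<^sup>2)"
    have c'_0: "2 * (\<Sum>i\<in>I. \<gamma>' i * Re ((- w i) ^ 0)) = 2 * c 0 + 2 * c 1"
    proof -
      have "(cmod (1 + w i))\<^sup>2 = 2 + 2 * Re (w i)" if "i \<in> I" for i
      proof -
        have "(Re (w i))\<^sup>2 + (Im (w i))\<^sup>2 = 1" using norm_w[OF that] by (simp flip: cmod_power2)
        thus ?thesis unfolding cmod_power2 by (simp add: power2_eq_square algebra_simps)
      qed
      thus ?thesis by (simp add: \<gamma>'_def c_eq algebra_simps sum.distrib sum_distrib_left sum_distrib_right)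
    qed
    \<comment> \<open>Here \<open>|1 + w|\<^sup>2 = 2 + w + cnj w\<close>. For the alternating
      pattern the bracket cancels at indices 2 to 7, which uses \<open>c\<close> up to 8, and index
      1 gives \<open>- 1\<close>.\<close>
    have c'_Suc: "2 * (\<Sum>i\<in>I. \<gamma>' i * Re ((- w i) ^ Suc k)) =
        of_int ((- 1) ^ Suc k * (2 * c (Suc k) + c (Suc (Suc k)) + c k))" for k
    proof -
      have "(cmod (1 + w i))\<^sup>2 * Re ((- w i) ^ Suc k) =
          (- 1) ^ Suc k * (2 * Re (w i ^ Suc k) + Re (w i ^ Suc (Suc k)) + Re (w i ^ k))" if "i \<in> I" for i
      proof -
        have "of_real ((cmod (1 + w i))\<^sup>2) = 2 + w i + cnj (w i)"
          unfolding complex_norm_square using cnj_w[OF that] by (simp add: algebra_simps)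
        hence "of_real ((cmod (1 + w i))\<^sup>2) * w i ^ Suc k =
            2 * w i ^ Suc k + w i ^ Suc (Suc k) + (w i * cnj (w i)) * w i ^ k"
          by (simp add: algebra_simps)
        hence "Re (of_real ((cmod (1 + w i))\<^sup>2) * w i ^ Suc k) =
            2 * Re (w i ^ Suc k) + Re (w i ^ Suc (Suc k)) + Re (w i ^ k)"
          by (simp only: cnj_w[OF that]) simp
        hence "(cmod (1 + w i))\<^sup>2 * Re (w i ^ Suc k) =
            2 * Re (w i ^ Suc k) + Re (w i ^ Suc (Suc k)) + Re (w i ^ k)"
          by (simp only: scaleR_complex.sel flip: scaleR_conv_of_real)
        moreover have "(- w i) ^ Suc k = of_real ((- 1) ^ Suc k) * w i ^ Suc k"
          by (subst power_minus) simp
        hence "Re ((- w i) ^ Suc k) = (- 1) ^ Suc k * Re (w i ^ Suc k)"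
          by (simp only: scaleR_complex.sel flip: scaleR_conv_of_real)
        ultimately show ?thesis by (simp only: mult.left_commute)
      qed
      hence "\<gamma>' i * Re ((- w i) ^ Suc k) =
          \<gamma> i * ((- 1) ^ Suc k * (2 * Re (w i ^ Suc k) + Re (w i ^ Suc (Suc k)) + Re (w i ^ k)))"
        if "i \<in> I" for i
        using that unfolding \<gamma>'_def by (simp only: mult.assoc)
      hence "2 * (\<Sum>i\<in>I. \<gamma>' i * Re ((- w i) ^ Suc k)) =
          2 * (\<Sum>i\<in>I. \<gamma> i * ((- 1) ^ Suc k * (2 * Re (w i ^ Suc k) + Re (w i ^ Suc (Suc k)) + Re (w i ^ k))))"
        by simp
      also have "\<dots> = of_int ((- 1) ^ Suc k * (2 * c (Suc k) + c (Suc (Suc k)) + c k))"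
        by (simp add: c_eq algebra_simps sum.distrib sum_distrib_left del: power_Suc)
      finally show ?thesis .
    qed
    interpret alt: root_weights I \<gamma>' "\<lambda>i. - w i"
    proof
      fix i assume i: "i \<in> I"
      have "w i \<noteq> - 1"
      proof
        assume "w i = - 1"
        hence "p * q dvd 1" using primitive_root_power_eq_1_iff[OF square[OF i], of 1] by simp
        thus False using q by simp
      qed
      hence "1 + w i \<noteq> 0" by (simp add: add_eq_0_iff)
      thus "\<gamma>' i > 0" using pos[OF i] by (simp add: \<gamma>'_def)
    next
      show "(\<Sum>i\<in>I. \<gamma>' i) = 1" using c'_0 c_0 c1 by simp
    next
      fix k
      show "2 * (\<Sum>i\<in>I. \<gamma>' i * Re ((- w i) ^ k)) \<in> \<int>"
      proof (cases k)
        case (Suc l)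
        show ?thesis unfolding Suc c'_Suc by (rule Ints_of_int)
      qed (simp add: c'_0[simplified])
    qed (use finite_I norm_w in auto)
    have c': "alt.c (Suc k) = (- 1) ^ Suc k * (2 * c (Suc k) + c (Suc (Suc k)) + c k)" for k
      using alt.c_eq[of "Suc k"] unfolding c'_Suc of_int_eq_iff .
    have "alt.c 1 = - 1" using c'[of 0] alt c_0 by simp
    moreover have "alt.c k = 0" if "k \<in> {2..7}" for k
    proof -
      obtain l where "k = Suc l" using \<open>k \<in> {2..7}\<close> by (cases k) auto
      thus ?thesis using c'[of l] alt that by simp
    qed
    ultimately show False
      using alt.path_contradiction[OF _ _ p q(2)] square by simp
  qed
qed

end

section \<open>Reduction to two primes\<close>

lemma coprime_primes_combination:
  fixes p q j l :: nat
  assumes "prime p" "prime q" "p \<noteq> q" "j \<in> {1..<p}" "l \<in> {1..<q}"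
  shows "coprime (q * j + p * l) (p * q)"
proof -
  have "\<not> p dvd j" "\<not> q dvd l" using assms(4,5) by (auto dest: dvd_imp_le)
  moreover have "\<not> p dvd q" "\<not> q dvd p" using assms(1-3) primes_dvd_imp_eq by blast+
  ultimately have "\<not> p dvd q * j + p * l" "\<not> q dvd q * j + p * l"
    using assms(1,2) by (auto simp: dvd_add_left_iff dvd_add_right_iff prime_dvd_mult_iff)
  thus ?thesis
    using assms(1,2) by (simp add: prime_imp_coprime coprime_commute[of "q * j + p * l"])
qed

text \<open>If \<open>c\<close> vanished at all \<open>k\<close> prime to \<open>p * q\<close>, the
  relation along \<open>q * j + p * l\<close> would give \<open>c (q * j) = 0\<close> for
  \<open>0 < j < p\<close>, and then the sum over \<open>j\<close> would give
  \<open>c 0 = 0\<close>.\<close>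

lemma no_root_weights:
  assumes "root_weights I \<gamma> z" and p: "prime p" "odd p" and q: "prime q" "odd q" and "p \<noteq> q"
    and large: "totient (p * q) > 10"
    and prim: "\<And>i. i \<in> I \<Longrightarrow> primitive_root_of_unity (p * q) (z i)"
  shows False
proof -
  interpret root_weights I \<gamma> z by fact
  have pq: "p \<ge> 2" "q \<ge> 2" using p q by (simp_all add: prime_ge_2_nat)
  obtain i0 where i0: "i0 \<in> I" using total by (cases "I = {}") auto
  have relation: "(\<Sum>j<a. c (x + b * j)) = 0" if ab: "a * b = p * q" "a > 1" for a b x
  proof (rule c_sum)
    fix i assume i: "i \<in> I"
    note iff = primitive_root_power_eq_1_iff[OF prim[OF i], folded ab(1)]
    have "b > 0" using ab pq by (cases b) auto
    hence "z i ^ b \<noteq> 1" using ab(2) unfolding iff by (auto dest: dvd_imp_le)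
    moreover have "(z i ^ b) ^ a = 1" using iff by (simp add: mult.commute flip: power_mult)
    ultimately have "(\<Sum>j<a. (z i ^ b) ^ j) = 0" by (rule sum_powers_root_of_unity[rotated])
    thus "(\<Sum>j<a. z i ^ (x + b * j)) = 0"
      by (simp add: power_add power_mult flip: sum_distrib_left)
  qed
  have "\<exists>k. coprime k (p * q) \<and> c k \<noteq> 0"
  proof (rule ccontr)
    assume "\<not> ?thesis"
    hence zero: "c k = 0" if "coprime k (p * q)" for k using that by blast
    have "c (0 + q * j) = 0" if j: "j \<in> {1..<p}" for j
    proof -
      have "(\<Sum>l<q. c (q * j + p * l)) = 0" using pq by (intro relation) auto
      moreover have "c (q * j + p * l) = 0" if "l \<in> {1..<q}" for l
        using coprime_primes_combination[OF p(1) q(1) \<open>p \<noteq> q\<close> j that] by (rule zero)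
      moreover have "{..<q} = insert 0 {1..<q}" using pq by auto
      ultimately show ?thesis by simp
    qed
    moreover have "(\<Sum>j<p. c (0 + q * j)) = 0" using pq by (intro relation) auto
    moreover have "{..<p} = insert 0 {1..<p}" using pq by auto
    ultimately show False using c_0 by simp
  qed
  then obtain k where k: "coprime k (p * q)" "c k \<noteq> 0" by blast
  have "\<bar>c k\<bar> \<noteq> 2"
  proof
    assume "\<bar>c k\<bar> = 2"
    hence "c k = 2 * 1 \<or> c k = 2 * - 1" by linarith
    hence "z i0 ^ k = 1 \<or> z i0 ^ k = - 1" using c_extreme[of k _ i0] i0 by fastforce
    hence "z i0 ^ (k * 2) = 1" unfolding power_mult by auto
    hence "p * q dvd k * 2" using primitive_root_power_eq_1_iff[OF prim[OF i0]] by blast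
    moreover have "coprime (p * q) (k * 2)" using k(1) p(2) q(2) by (simp add: coprime_commute)
    ultimately have "p * q dvd 1" using coprime_absorb_left by blast
    thus False using pq by simp
  qed
  \<comment> \<open>Chosen so that the new first entry is
    \<open>e * c k = - (c k)\<^sup>2 = - 1\<close>.\<close>
  define e where "e = - c k"
  have e: "\<bar>e\<bar> = 1" using \<open>\<bar>c k\<bar> \<noteq> 2\<close> k(2) c_bound[of k] by (simp add: e_def)
  hence e2: "e * e = 1" by (metis abs_mult_self_eq mult_1)
  define w where "w = (\<lambda>i. of_int e * z i ^ k)"
  have w_power: "Re (w i ^ j) = of_int (e ^ j) * Re (z i ^ (k * j))" for i j
  proof -
    have "w i ^ j = of_real (of_int (e ^ j)) * z i ^ (k * j)"
      by (simp add: w_def power_mult_distrib power_mult)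
    thus ?thesis by simp
  qed
  have w_c: "2 * (\<Sum>i\<in>I. \<gamma> i * Re (w i ^ j)) = of_int (e ^ j * c (k * j))" for j
    unfolding w_power of_int_mult c_eq by (simp add: sum_distrib_left mult_ac)
  interpret w: root_weights I \<gamma> w
  proof
    show "2 * (\<Sum>i\<in>I. \<gamma> i * Re (w i ^ j)) \<in> \<int>" for j unfolding w_c by (rule Ints_of_int)
    show "cmod (w i) = 1" if "i \<in> I" for i
      using norm_w[OF that] e by (simp add: w_def norm_mult norm_power)
  qed (use finite_I pos total in auto)
  have "w.c 1 = e * c k" using w.c_eq[of 1] unfolding w_c of_int_eq_iff by simp
  hence w1: "w.c 1 = - 1" using e2 by (simp add: e_def)
  have "primitive_root_of_unity (p * q) (of_int e * w i)" if i: "i \<in> I" for i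
  proof -
    have "of_int e * w i = of_int (e * e) * z i ^ k" by (simp add: w_def)
    hence w: "of_int e * w i = z i ^ k" by (simp add: e2)
    have "(z i ^ k) ^ j = 1 \<longleftrightarrow> p * q dvd j" for j
      using primitive_root_power_eq_1_iff[OF prim[OF i], of "k * j"] k(1)
      by (simp add: coprime_dvd_mult_right_iff coprime_commute flip: power_mult)
    thus ?thesis
      using pq by (auto simp: w primitive_root_of_unity_def dest: dvd_imp_le)
  qed
  from w.no_weights_of_c1[OF w1 p q(2) _ large this e] show False using pq by simp
qed

section \<open>Choice of the two odd primes\<close>

lemma squarefree_dvd_prod:
  fixes d :: nat
  assumes "squarefree d" "finite A" "prime_factors d \<subseteq> A"
  shows "d dvd \<Prod>A"
proof -
  have "d \<noteq> 0" using assms(1) by (metis not_squarefree_0)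
  hence "d = (\<Prod>p\<in>prime_factors d. p ^ multiplicity p d)"
    using prime_factorization_nat by simp
  also have "\<dots> = \<Prod>(prime_factors d)"
    using assms(1) \<open>d \<noteq> 0\<close> by (intro prod.cong) (auto simp: squarefree_factorial_semiring')
  also have "\<dots> dvd \<Prod>A" using assms by (intro prod_dvd_prod_subset)
  finally show ?thesis .
qed

text \<open>Without a prime factor \<open>q \<ge> 7\<close>, \<open>d\<close> would divide 30;
  without a second odd one it would be \<open>q\<close> or \<open>2 * q\<close>. Then the totient is
  at least \<open>2 * 6\<close>.\<close>

lemma two_odd_prime_factors:
  fixes d :: nat
  assumes d: "squarefree d" "\<not> prime d" "\<not> (\<exists>p. prime p \<and> d = 2 * p)" "d > 20" "d \<noteq> 30"
  obtains p q where "prime p" "odd p" "prime q" "odd q" "p \<noteq> q" "p * q dvd d" "totient (p * q) > 10"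
proof -
  have "\<exists>q. prime q \<and> q dvd d \<and> q \<notin> {2, 3, 5}"
  proof (rule ccontr)
    assume "\<not> ?thesis"
    hence "prime_factors d \<subseteq> {2, 3, 5}" by (auto simp: prime_factors_dvd)
    hence "d dvd 30" using squarefree_dvd_prod[OF d(1), of "{2, 3, 5}"] by simp
    then obtain k where k: "30 = d * k" by blast
    have "k < 2"
    proof (rule ccontr)
      assume "\<not> k < 2"
      hence "21 * 2 \<le> d * k" using d(4) by (intro mult_le_mono) auto
      thus False using k by simp
    qed
    thus False using k d(5) by (auto simp: less_2_cases_iff)
  qed
  then obtain q where q: "prime q" "q dvd d" "q \<notin> {2, 3, 5}" by blast
  have "q \<noteq> 4" "q \<noteq> 6" using q(1) by auto
  hence q7: "q \<ge> 7" using q(3) prime_ge_2_nat[OF q(1)] by auto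
  have odd_q: "odd q" using q(1) q7 prime_odd_nat by auto
  have "\<exists>p. prime p \<and> p dvd d \<and> p \<notin> {2, q}"
  proof (rule ccontr)
    assume "\<not> ?thesis"
    hence "prime_factors d \<subseteq> {2, q}" by (auto simp: prime_factors_dvd)
    hence "d dvd 2 * q" using squarefree_dvd_prod[OF d(1), of "{2, q}"] q7 by simp
    then obtain k where k: "2 * q = d * k" by blast
    from q(2) obtain l where l: "d = q * l" by blast
    have "2 = l * k" using k l q7 by (simp add: mult.assoc)
    hence "l = 1 \<or> l = 2" by (metis dvd_triv_left prime_nat_iff two_is_prime_nat)
    thus False using d(2,3) q(1) l by (auto simp: mult.commute)
  qed
  then obtain p where p: "prime p" "p dvd d" "p \<notin> {2, q}" by blast
  have p3: "p \<ge> 3" using p(3) prime_ge_2_nat[OF p(1)] by simp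
  have odd_p: "odd p" using p(1) p3 prime_odd_nat by auto
  have cop: "coprime p q" using p q by (intro primes_coprime) auto
  have "totient (p * q) = (p - 1) * (q - 1)"
    using cop p(1) q(1) by (simp add: totient_mult_coprime totient_prime)
  moreover have "2 * 6 \<le> (p - 1) * (q - 1)" using p3 q7 by (intro mult_le_mono) auto
  ultimately show ?thesis
    using p q odd_p odd_q divides_mult[OF p(2) q(2) cop] by (intro that[of p q]) auto
qed

theorem theorem2:
  fixes d :: nat and \<zeta> :: complex and f :: "int poly"
  assumes "squarefree d"
    and "\<not> prime d"
    and "\<not> (\<exists>p. prime p \<and> d = 2 * p)"
    and "d > 20"
    and "d \<noteq> 30"
    and "primitive_root_of_unity d \<zeta>"
    and "is_min_int_poly f (\<zeta> + inverse \<zeta>)"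
  shows "non_interlacing f"
  unfolding non_interlacing_def
proof (intro notI, elim exE conjE)
  fix g :: "int poly" assume "interlaces g f"
  obtain n :: nat and \<gamma> :: "nat \<Rightarrow> real" and z :: "nat \<Rightarrow> complex" where weights: "\<forall>i\<in>{1..n}. \<gamma> i > 0 \<and> primitive_root_of_unity d (z i)"
    "\<forall>k. 2 * (\<Sum>i = 1..n. \<gamma> i * Re (z i ^ k)) \<in> \<int>" "(\<Sum>i = 1..n. \<gamma> i) = 1"
    using interlacing_root_weights[OF assms(6,7) \<open>interlaces g f\<close>] by blast
  obtain p q where pq: "prime p" "odd p" "prime q" "odd q" "p \<noteq> q" "p * q dvd d" "totient (p * q) > 10"
    by (rule two_odd_prime_factors[OF assms(1-5)]) (rule that)
  \<comment> \<open>The moments of \<open>z i ^ k\<close> are among those of \<open>z i\<close>, so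
    integrality survives the passage to order \<open>p * q\<close>.\<close>
  then obtain k where k: "d = k * (p * q)" by (auto simp: mult.commute)
  have "k > 0" "p * q > 0" using assms(4) k by (cases k; cases "p * q"; simp)+
  have norm: "cmod (z i) = 1" if "i \<in> {1..n}" for i
    using weights(1) that by (auto simp: primitive_root_of_unity_def intro: root_of_unity_norm)
  have "primitive_root_of_unity (p * q) (z i ^ k)" if i: "i \<in> {1..n}" for i
  proof -
    have "(z i ^ k) ^ j = 1 \<longleftrightarrow> p * q dvd j" for j
      using primitive_root_power_eq_1_iff[of d "z i" "k * j"] weights(1) i \<open>k > 0\<close>
      by (simp add: k flip: power_mult)
    thus ?thesis using \<open>p * q > 0\<close> by (auto simp: primitive_root_of_unity_def dest: dvd_imp_le)
  qed
  moreover have "root_weights {1..n} \<gamma> (\<lambda>i. z i ^ k)"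
    using weights norm by unfold_locales (auto simp: norm_power simp flip: power_mult)
  ultimately show False using no_root_weights pq by blast
qed

end
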